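(* Let $\mathcal C=(C,G,\delta)$ be a crossed module of groupoids. The braided regular crossed module $\mathcal A=\mathrm{AUT}(\mathcal C)$ corresponds, via the equivalence between braided regular crossed modules and 2-crossed modules, to the 2-crossed module $$M_2(\mathcal C)\xrightarrow{\ \zeta\ }FDer^*(\mathcal C)\xrightarrow{\ \Delta\ }\mathrm{Aut}(\mathcal C).$$ That is, the 2-crossed module $A_2(e)\xrightarrow{\delta}K\xrightarrow{\alpha}A_0$ associated to $\mathcal A=\mathrm{AUT}(\mathcal C)$ is, under the identifications $(s_2,I)\leftrightarrow s_2$ of $A_2(e)$ with $M_2(\mathcal C)$ and $(s_0,s_1,I)\leftrightarrow(s_0,s_1)$ of $K$ with $FDer^*(\mathcal C)$ (with $e=I$ the identity automorphism and $A_0=\mathrm{Aut}(\mathcal C)$), the sequence of groups above, with $\delta$ becoming $\zeta$ and $\alpha$ becoming $\Delta$.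
   Context: Conventions: source and target maps of a groupoid are $\alpha,\beta$; composition is additive, $a+b$ being defined when $\beta a=\alpha b$; $G(x,y)$ is the set of $a$ with $\alpha a=x,\beta a=y$; $O_x$ is the identity at $x$. A groupoid is totally intransitive if $\alpha=\beta$; then $C(x)=C(x,x)$. Crossed modules of groupoids. $\mathcal C=(C,G,\delta)$ consists of groupoids $C,G$ over the same object set $X$, $C$ totally intransitive, a morphism $\delta:C\to G$ identity on objects, and an action $(c,a)\mapsto c^a$ defined iff $\beta c=\alpha a$, with $\beta(c^a)=\beta a$, $(c_1+c_2)^a=c_1^a+c_2^a$, $c^{a+b}=(c^a)^b$, $c^{O_x}=c$, such that $\delta(c^a)=-a+\delta c+a$ and $c^{\delta c_1}=-c_1+c+c_1$. A morphism is a triple $f=(f_0,f_1,f_2)$ (on objects, on $G$, on $C$) of compatible groupoid morphisms with $\delta' f_2=f_1\delta$, $f_2(c^a)=f_2(c)^{f_1(a)}$. $\mathrm{Aut}(\mathcal C)$ is the group of automorphisms under composition $fg=f\circ g$. Homotopies. For an endomorphism $f$ of $\mathcal C$, a homotopy on $f$ is $(s_0,s_1,f)$ with $s_0:X\to G$, $s_1:G\to C$, $\beta s_0(x)=f_0(x)$, $\beta s_1(a)=\beta f_1(a)$, $s_1(a+b)=s_1(a)^{f_1(b)}+s_1(b)$. Its source is the endomorphism $f^0$ with $f^0_0(x)=\alpha s_0(x)$, $f^0_1(a)=s_0(\alpha a)+f_1(a)+\delta s_1(a)-s_0(\beta a)$, $f^0_2(c)=(f_2(c)+s_1\delta c)^{-s_0(\beta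 c)}$. A homotopy on the identity $I$ is a free derivation $s=(s_0,s_1)$, and $\Delta(s)$ is its source. Free derivations form a monoid $FDer(\mathcal C)$ under $(s*t)_0(x)=s_0(g_0(x))+t_0(x)$, $(s*t)_1(a)=t_1(a)+(s_1(g_1(a)))^{t_0(\beta a)}$, $g=\Delta(t)$; $FDer^*(\mathcal C)$ is its group of units. $\mathrm{Aut}(\mathcal C)$ acts on $FDer^*(\mathcal C)$ by $(s_0,s_1)^f=(f_1^{-1}s_0f_0,\ f_2^{-1}s_1f_1)$. $M_2(\mathcal C)$ is the group of sections $s_2:X\to C$ of $\beta$ under pointwise addition, with $\zeta(s_2)=(\delta s_2,s_1)$, $s_1(a)=-s_2(\alpha a)^a+s_2(\beta a)$. $\mathrm{Aut}(\mathcal C)$ acts on $M_2(\mathcal C)$ by $s_2^f=f_2^{-1}s_2f_0$, and $FDer^*(\mathcal C)$ acts on $M_2(\mathcal C)$ by $s_2^{(t_0,t_1)}(x)=s_2(\alpha t_0(x))^{t_0(x)}$. These are the actions on the displayed 2-crossed module. Braided regular crossed modules. Write a crossed module of groupoids as $\mathcal A=(A_2,A_1,\delta)$ with object set $A_0$. It is braided regular if $A_0$ is a group (identity $e$), $A_0$ acts on the left and right of the groupoids $A_1,A_2$, the actions commuting ($x.(c.y)=(x.c).y$), preserving composition, with $\alpha,\beta,\delta$ equivariant, $z.(c^a)=(z.c)^{z.a}$, $(c^a).z=(c.z)^{a.z}$; and there is a map $\{\,,\}:A_1\times A_1\to A_2$ with: $\{a,b\}\in A_2((\beta a)(\beta b))$;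 $\{O_e,b\}=O_{\beta b}$, $\{a,O_e\}=O_{\beta a}$; $\{a,b+b'\}=\{a,b\}^{\beta a.b'}+\{a,b'\}$; $\{a+a',b\}=\{a',b\}+\{a,b\}^{a'.\beta b}$; $\delta\{a,b\}=-(\beta a.b)-a.\alpha b+\alpha a.b+a.\beta b$; $\{a,\delta c'\}=-(\beta a.c')+(\alpha a.c')^{a.y}$ if $c'\in A_2(y)$; $\{\delta c,b\}=-(c.\alpha b)^{x.b}+c.\beta b$ if $c\in A_2(x)$; $x.\{a,b\}=\{x.a,b\}$, $\{a,b\}.x=\{a,b.x\}$, $\{a.x,b\}=\{a,x.b\}$. $\mathrm{AUT}(\mathcal C)$. $A_0=\mathrm{Aut}(\mathcal C)$. $A_1$ is the set of homotopies $(s_0,s_1,f)$ with $f$ and the source $f^0$ both automorphisms; $\alpha(s_0,s_1,f)=f^0$, $\beta(s_0,s_1,f)=f$; when $f$ is the source of $(t_0,t_1,g)$, $(s_0,s_1,f)+(t_0,t_1,g)=(u_0,u_1,g)$ with $u_0(x)=s_0(x)+t_0(x)$, $u_1(a)=t_1(a)+s_1(a)^{t_0(\beta a)}$. $A_2$ is the set of pairs $(s_2,f)$, $f\in A_0$, $s_2:X\to C$ with $\beta s_2(x)=f_0(x)$; $(s_2,f)$ is a loop at $f$, added pointwise; $\delta(s_2,f)=(\delta s_2,s_1,f)$ with $s_1(a)=-s_2(\alpha a)^{f_1(a)}+s_2(\beta a)$; if $f$ is the source of $(t_0,t_1,g)$, $(s_2,f)^{(t_0,t_1,g)}=(x\mapsto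 s_2(x)^{t_0(x)},\,g)$. For $h\in A_0$: $h.(s_0,s_1,f)=(h_1s_0,h_2s_1,hf)$, $(s_0,s_1,f).h=(s_0h_0,s_1h_1,fh)$, $h.(s_2,f)=(h_2s_2,hf)$, $(s_2,f).h=(s_2h_0,fh)$. The braiding is $\{(s_0,s_1,f),(t_0,t_1,f')\}=(s_1t_0,\ ff')$. 2-crossed modules. A 2-crossed module consists of groups and homomorphisms $L\xrightarrow{\partial}M\xrightarrow{\partial}P$ with $\partial\partial$ trivial, right actions of $P$ on $L,M$ by automorphisms ($P$ acting on itself by conjugation) for which the maps $\partial$ are $P$-equivariant, an action of $M$ on $L$ making $L\to M$ a crossed module of groups with $(l^m)^p=(l^p)^{m^p}$, and a Peiffer lifting $\langle\,,\rangle:M\times M\to L$ with: $\partial\langle m_0,m_1\rangle=m_0^{-1}m_1^{-1}m_0m_1^{\partial m_0}$; $\langle\partial l,m\rangle=l^{-1}l^m$; $\langle m,\partial l\rangle=(l^{m})^{-1}l^{\partial m}$; $\langle m_0,m_1m_2\rangle=\langle m_0,m_2\rangle\langle m_0,m_1\rangle^{m_2^{\partial m_0}}$; $\langle m_0m_1,m_2\rangle=\langle m_0,m_2\rangle^{m_1}\langle m_1,m_2^{\partial m_0}\rangle$; $\langle m_0,m_1\rangle^p=\langle m_0^p,m_1^p\rangle$. The correspondence. To a braided regular crossed module $\mathcal A$ is associated the 2-crossed module $A_2(e)\xrightarrow{\delta}K\xrightarrow{\alpha}A_0$, where $K=\{a\in A_1:\beta a=e\}$ is the group with product $ab=(a.\alpha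 b)+b$; $A_0$ acts by $a^p=p^{-1}.a.p$ on $K$ and similarly on $A_2(e)$; $K$ acts on $A_2(e)$ by $c!a=(c.\alpha a)^a$; and the Peiffer lifting is $\langle a,b\rangle=\{a^{-1},b\}!a$. *)

theory Defs
  imports "HOL-Algebra.Group" "HOL-Library.FuncSet"
begin

text \<open>
  Throughout, maps between carriers are \<^const>\<open>extensional\<close>, so that equality of HOL functions
  is equality of maps.
\<close>

text \<open>Composition is additive and diagrammatic: \<open>a \<boxplus> b\<close> is meaningful when
  \<open>tgt a = src b\<close>. Outside the carrier the fields are unconstrained.\<close>

record ('x, 'a) groupoid =
  obj :: "'x set"
  arr :: "'a set"
  src :: "'a \<Rightarrow> 'x"
  tgt :: "'a \<Rightarrow> 'x"
  add :: "'a \<Rightarrow> 'a \<Rightarrow> 'a"  (infixl \<open>\<boxplus>\<index>\<close> 65)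
  idt :: "'x \<Rightarrow> 'a"

definition is_neg :: "('x, 'a, 'm) groupoid_scheme \<Rightarrow> 'a \<Rightarrow> 'a \<Rightarrow> bool" where
  "is_neg G a b \<longleftrightarrow> b \<in> arr G \<and> src G b = tgt G a \<and> tgt G b = src G a \<and>
     a \<boxplus>\<^bsub>G\<^esub> b = idt G (src G a) \<and> b \<boxplus>\<^bsub>G\<^esub> a = idt G (tgt G a)"

definition neg :: "('x, 'a, 'm) groupoid_scheme \<Rightarrow> 'a \<Rightarrow> 'a"  (\<open>\<boxminus>\<index> _\<close> [81] 80) where
  "\<boxminus>\<^bsub>G\<^esub> a = (THE b. is_neg G a b)"

locale groupoid =
  fixes G (structure)
  assumes src_closed: "a \<in> arr G \<Longrightarrow> src G a \<in> obj G"
    and tgt_closed: "a \<in> arr G \<Longrightarrow> tgt G a \<in> obj G"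
    and add_closed: "\<lbrakk>a \<in> arr G; b \<in> arr G; tgt G a = src G b\<rbrakk> \<Longrightarrow> a \<boxplus> b \<in> arr G"
    and src_add: "\<lbrakk>a \<in> arr G; b \<in> arr G; tgt G a = src G b\<rbrakk> \<Longrightarrow> src G (a \<boxplus> b) = src G a"
    and tgt_add: "\<lbrakk>a \<in> arr G; b \<in> arr G; tgt G a = src G b\<rbrakk> \<Longrightarrow> tgt G (a \<boxplus> b) = tgt G b"
    and add_assoc: "\<lbrakk>a \<in> arr G; b \<in> arr G; c \<in> arr G; tgt G a = src G b; tgt G b = src G c\<rbrakk>
      \<Longrightarrow> (a \<boxplus> b) \<boxplus> c = a \<boxplus> (b \<boxplus> c)"
    and idt_closed: "x \<in> obj G \<Longrightarrow> idt G x \<in> arr G"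
    and src_idt: "x \<in> obj G \<Longrightarrow> src G (idt G x) = x"
    and tgt_idt: "x \<in> obj G \<Longrightarrow> tgt G (idt G x) = x"
    and idt_add: "a \<in> arr G \<Longrightarrow> idt G (src G a) \<boxplus> a = a"
    and add_idt: "a \<in> arr G \<Longrightarrow> a \<boxplus> idt G (tgt G a) = a"
    and neg_ex: "a \<in> arr G \<Longrightarrow> \<exists>b. is_neg G a b"

text \<open>\<open>act X c a\<close>, written \<open>c \<star> a\<close>, is $c^a$; it is meaningful when the target of \<open>c\<close> is
  the source of \<open>a\<close>.\<close>

record ('x, 'g, 'c) xmod =
  base :: "('x, 'g) groupoid"
  fib :: "('x, 'c) groupoid"
  bd :: "'c \<Rightarrow> 'g"
  act :: "'c \<Rightarrow> 'g \<Rightarrow> 'c"  (infixl \<open>\<star>\<index>\<close> 75)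

locale crossed_module =
  fixes X :: "('x, 'g, 'c, 'm) xmod_scheme" (structure)
  fixes G C
  defines "G \<equiv> base X" and "C \<equiv> fib X"
  assumes base_groupoid: "groupoid G"
    and fib_groupoid: "groupoid C"
    and same_obj: "obj C = obj G"
    and tot_intrans: "c \<in> arr C \<Longrightarrow> src C c = tgt C c"
    and bd_closed: "c \<in> arr C \<Longrightarrow> bd X c \<in> arr G"
    and src_bd: "c \<in> arr C \<Longrightarrow> src G (bd X c) = src C c"
    and tgt_bd: "c \<in> arr C \<Longrightarrow> tgt G (bd X c) = tgt C c"
    and bd_add: "\<lbrakk>c \<in> arr C; d \<in> arr C; tgt C c = src C d\<rbrakk>
      \<Longrightarrow> bd X (c \<boxplus>\<^bsub>C\<^esub> d) = bd X c \<boxplus>\<^bsub>G\<^esub> bd X d"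
    and act_closed: "\<lbrakk>c \<in> arr C; a \<in> arr G; tgt C c = src G a\<rbrakk> \<Longrightarrow> c \<star> a \<in> arr C"
    and tgt_act: "\<lbrakk>c \<in> arr C; a \<in> arr G; tgt C c = src G a\<rbrakk> \<Longrightarrow> tgt C (c \<star> a) = tgt G a"
    and add_act: "\<lbrakk>c \<in> arr C; d \<in> arr C; a \<in> arr G; tgt C c = tgt C d; tgt C c = src G a\<rbrakk>
      \<Longrightarrow> (c \<boxplus>\<^bsub>C\<^esub> d) \<star> a = c \<star> a \<boxplus>\<^bsub>C\<^esub> d \<star> a"
    and act_add: "\<lbrakk>c \<in> arr C; a \<in> arr G; b \<in> arr G; tgt C c = src G a; tgt G a = src G b\<rbrakk>
      \<Longrightarrow> c \<star> (a \<boxplus>\<^bsub>G\<^esub> b) = (c \<star> a) \<star> b"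
    and act_idt: "c \<in> arr C \<Longrightarrow> c \<star> idt G (tgt C c) = c"
    and bd_act: "\<lbrakk>c \<in> arr C; a \<in> arr G; tgt C c = src G a\<rbrakk>
      \<Longrightarrow> bd X (c \<star> a) = \<boxminus>\<^bsub>G\<^esub> a \<boxplus>\<^bsub>G\<^esub> bd X c \<boxplus>\<^bsub>G\<^esub> a"
    and act_bd: "\<lbrakk>c \<in> arr C; d \<in> arr C; tgt C c = tgt C d\<rbrakk>
      \<Longrightarrow> c \<star> bd X d = \<boxminus>\<^bsub>C\<^esub> d \<boxplus>\<^bsub>C\<^esub> c \<boxplus>\<^bsub>C\<^esub> d"

abbreviation objs :: "('x, 'g, 'c, 'm) xmod_scheme \<Rightarrow> 'x set" where
  "objs X \<equiv> obj (base X)"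

record ('x, 'g, 'c) xmor =
  m0 :: "'x \<Rightarrow> 'x"
  m1 :: "'g \<Rightarrow> 'g"
  m2 :: "'c \<Rightarrow> 'c"

definition groupoid_hom ::
  "('x, 'a, 'm) groupoid_scheme \<Rightarrow> ('y, 'b, 'n) groupoid_scheme \<Rightarrow> ('x \<Rightarrow> 'y) \<Rightarrow> ('a \<Rightarrow> 'b) \<Rightarrow> bool" where
  "groupoid_hom G H f0 f1 \<longleftrightarrow>
     f0 \<in> obj G \<rightarrow>\<^sub>E obj H \<and> f1 \<in> arr G \<rightarrow>\<^sub>E arr H \<and>
     (\<forall>a\<in>arr G. src H (f1 a) = f0 (src G a) \<and> tgt H (f1 a) = f0 (tgt G a)) \<and>
     (\<forall>a\<in>arr G. \<forall>b\<in>arr G. tgt G a = src G b \<longrightarrow> f1 (a \<boxplus>\<^bsub>G\<^esub> b) = f1 a \<boxplus>\<^bsub>H\<^esub> f1 b)"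

definition xend :: "('x, 'g, 'c, 'm) xmod_scheme \<Rightarrow> ('x, 'g, 'c) xmor set" where
  "xend X = {f. groupoid_hom (base X) (base X) (m0 f) (m1 f) \<and>
     groupoid_hom (fib X) (fib X) (m0 f) (m2 f) \<and>
     (\<forall>c\<in>arr (fib X). bd X (m2 f c) = m1 f (bd X c)) \<and>
     (\<forall>c\<in>arr (fib X). \<forall>a\<in>arr (base X). tgt (fib X) c = src (base X) a \<longrightarrow>
        m2 f (c \<star>\<^bsub>X\<^esub> a) = m2 f c \<star>\<^bsub>X\<^esub> m1 f a)}"

definition End_monoid :: "('x, 'g, 'c, 'm) xmod_scheme \<Rightarrow> ('x, 'g, 'c) xmor monoid" where
  "End_monoid X = \<lparr>
     carrier = xend X,
     mult = (\<lambda>f g. \<lparr>m0 = compose (objs X) (m0 f) (m0 g),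
                    m1 = compose (arr (base X)) (m1 f) (m1 g),
                    m2 = compose (arr (fib X)) (m2 f) (m2 g)\<rparr>),
     one = \<lparr>m0 = (\<lambda>x\<in>objs X. x), m1 = (\<lambda>a\<in>arr (base X). a), m2 = (\<lambda>c\<in>arr (fib X). c)\<rparr>\<rparr>"

definition Aut :: "('x, 'g, 'c, 'm) xmod_scheme \<Rightarrow> ('x, 'g, 'c) xmor monoid" where
  "Aut X = units_of (End_monoid X)"

record ('x, 'g, 'c) htpy =
  h0 :: "'x \<Rightarrow> 'g"
  h1 :: "'g \<Rightarrow> 'c"
  hbase :: "('x, 'g, 'c) xmor"

definition homotopy :: "('x, 'g, 'c, 'm) xmod_scheme \<Rightarrow> ('x, 'g, 'c) htpy \<Rightarrow> bool" where
  "homotopy X s \<longleftrightarrow> (let G = base X; C = fib X; f = hbase s in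
     f \<in> xend X \<and>
     h0 s \<in> obj G \<rightarrow>\<^sub>E arr G \<and> h1 s \<in> arr G \<rightarrow>\<^sub>E arr C \<and>
     (\<forall>x\<in>obj G. tgt G (h0 s x) = m0 f x) \<and>
     (\<forall>a\<in>arr G. tgt C (h1 s a) = tgt G (m1 f a)) \<and>
     (\<forall>a\<in>arr G. \<forall>b\<in>arr G. tgt G a = src G b \<longrightarrow>
        h1 s (a \<boxplus>\<^bsub>G\<^esub> b) = h1 s a \<star>\<^bsub>X\<^esub> m1 f b \<boxplus>\<^bsub>C\<^esub> h1 s b))"

definition hsource :: "('x, 'g, 'c, 'm) xmod_scheme \<Rightarrow> ('x, 'g, 'c) htpy \<Rightarrow> ('x, 'g, 'c) xmor" where
  "hsource X s = (let G = base X; C = fib X; f = hbase s in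
     \<lparr>m0 = (\<lambda>x\<in>obj G. src G (h0 s x)),
      m1 = (\<lambda>a\<in>arr G. h0 s (src G a) \<boxplus>\<^bsub>G\<^esub> m1 f a \<boxplus>\<^bsub>G\<^esub> bd X (h1 s a) \<boxplus>\<^bsub>G\<^esub> \<boxminus>\<^bsub>G\<^esub> h0 s (tgt G a)),
      m2 = (\<lambda>c\<in>arr C. (m2 f c \<boxplus>\<^bsub>C\<^esub> h1 s (bd X c)) \<star>\<^bsub>X\<^esub> (\<boxminus>\<^bsub>G\<^esub> h0 s (tgt C c)))\<rparr>)"

text \<open>A free derivation \<open>(s\<^sub>0, s\<^sub>1)\<close> stands for the homotopy \<open>(s\<^sub>0, s\<^sub>1, I)\<close> on the identity.\<close>

definition fder_htpy ::
  "('x, 'g, 'c, 'm) xmod_scheme \<Rightarrow> ('x \<Rightarrow> 'g) \<times> ('g \<Rightarrow> 'c) \<Rightarrow> ('x, 'g, 'c) htpy" where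
  "fder_htpy X s = \<lparr>h0 = fst s, h1 = snd s, hbase = \<one>\<^bsub>End_monoid X\<^esub>\<rparr>"

definition Delta ::
  "('x, 'g, 'c, 'm) xmod_scheme \<Rightarrow> ('x \<Rightarrow> 'g) \<times> ('g \<Rightarrow> 'c) \<Rightarrow> ('x, 'g, 'c) xmor" where
  "Delta X s = hsource X (fder_htpy X s)"

definition FDer :: "('x, 'g, 'c, 'm) xmod_scheme \<Rightarrow> (('x \<Rightarrow> 'g) \<times> ('g \<Rightarrow> 'c)) monoid" where
  "FDer X = (let G = base X; C = fib X in \<lparr>
     carrier = {s. homotopy X (fder_htpy X s)},
     mult = (\<lambda>(s0, s1) (t0, t1). let g = Delta X (t0, t1) in
       (\<lambda>x\<in>obj G. s0 (m0 g x) \<boxplus>\<^bsub>G\<^esub> t0 x,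
        \<lambda>a\<in>arr G. t1 a \<boxplus>\<^bsub>C\<^esub> s1 (m1 g a) \<star>\<^bsub>X\<^esub> t0 (tgt G a))),
     one = (\<lambda>x\<in>obj G. idt G x, \<lambda>a\<in>arr G. idt C (tgt G a))\<rparr>)"

definition FDer_units :: "('x, 'g, 'c, 'm) xmod_scheme \<Rightarrow> (('x \<Rightarrow> 'g) \<times> ('g \<Rightarrow> 'c)) monoid" where
  "FDer_units X = units_of (FDer X)"

definition M2 :: "('x, 'g, 'c, 'm) xmod_scheme \<Rightarrow> ('x \<Rightarrow> 'c) monoid" where
  "M2 X = (let C = fib X in \<lparr>
     carrier = {s \<in> objs X \<rightarrow>\<^sub>E arr C. \<forall>x\<in>objs X. tgt C (s x) = x},
     mult = (\<lambda>s t. \<lambda>x\<in>objs X. s x \<boxplus>\<^bsub>C\<^esub> t x),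
     one = (\<lambda>x\<in>objs X. idt C x)\<rparr>)"

definition zeta ::
  "('x, 'g, 'c, 'm) xmod_scheme \<Rightarrow> ('x \<Rightarrow> 'c) \<Rightarrow> ('x \<Rightarrow> 'g) \<times> ('g \<Rightarrow> 'c)" where
  "zeta X s = (let G = base X; C = fib X in
     (\<lambda>x\<in>obj G. bd X (s x),
      \<lambda>a\<in>arr G. \<boxminus>\<^bsub>C\<^esub> (s (src G a) \<star>\<^bsub>X\<^esub> a) \<boxplus>\<^bsub>C\<^esub> s (tgt G a)))"

definition Aut_on_FDer ::
  "('x, 'g, 'c, 'm) xmod_scheme \<Rightarrow> ('x \<Rightarrow> 'g) \<times> ('g \<Rightarrow> 'c) \<Rightarrow> ('x, 'g, 'c) xmor
     \<Rightarrow> ('x \<Rightarrow> 'g) \<times> ('g \<Rightarrow> 'c)" where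
  "Aut_on_FDer X s f = (let f' = inv\<^bsub>Aut X\<^esub> f in
     (\<lambda>x\<in>objs X. m1 f' (fst s (m0 f x)),
      \<lambda>a\<in>arr (base X). m2 f' (snd s (m1 f a))))"

definition Aut_on_M2 ::
  "('x, 'g, 'c, 'm) xmod_scheme \<Rightarrow> ('x \<Rightarrow> 'c) \<Rightarrow> ('x, 'g, 'c) xmor \<Rightarrow> ('x \<Rightarrow> 'c)" where
  "Aut_on_M2 X s f = (\<lambda>x\<in>objs X. m2 (inv\<^bsub>Aut X\<^esub> f) (s (m0 f x)))"

definition FDer_on_M2 ::
  "('x, 'g, 'c, 'm) xmod_scheme \<Rightarrow> ('x \<Rightarrow> 'c) \<Rightarrow> ('x \<Rightarrow> 'g) \<times> ('g \<Rightarrow> 'c) \<Rightarrow> ('x \<Rightarrow> 'c)" where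
  "FDer_on_M2 X s t = (\<lambda>x\<in>objs X. s (src (base X) (fst t x)) \<star>\<^bsub>X\<^esub> fst t x)"

text \<open>\<open>lact1\<close>, \<open>ract1\<close> are the left and right actions of the group \<open>grp\<close> of objects on the
  groupoid $A_1$ (the \<open>base\<close> of \<open>xm\<close>), \<open>lact2\<close>, \<open>ract2\<close> those on $A_2$ (its \<open>fib\<close>).\<close>

record ('p, 'a, 'b) bxmod =
  grp :: "'p monoid"
  xm :: "('p, 'a, 'b) xmod"
  lact1 :: "'p \<Rightarrow> 'a \<Rightarrow> 'a"
  ract1 :: "'a \<Rightarrow> 'p \<Rightarrow> 'a"
  lact2 :: "'p \<Rightarrow> 'b \<Rightarrow> 'b"
  ract2 :: "'b \<Rightarrow> 'p \<Rightarrow> 'b"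
  brd :: "'a \<Rightarrow> 'a \<Rightarrow> 'b"

text \<open>Commuting left and right actions of a group on a groupoid whose objects are the elements of
  that group; on objects the actions are the left and right multiplications.\<close>

definition biaction ::
  "'p monoid \<Rightarrow> ('p, 'a) groupoid \<Rightarrow> ('p \<Rightarrow> 'a \<Rightarrow> 'a) \<Rightarrow> ('a \<Rightarrow> 'p \<Rightarrow> 'a) \<Rightarrow> bool" where
  "biaction P A l r \<longleftrightarrow>
     (\<forall>x\<in>carrier P. \<forall>a\<in>arr A.
        l x a \<in> arr A \<and> src A (l x a) = x \<otimes>\<^bsub>P\<^esub> src A a \<and> tgt A (l x a) = x \<otimes>\<^bsub>P\<^esub> tgt A a \<and>
        r a x \<in> arr A \<and> src A (r a x) = src A a \<otimes>\<^bsub>P\<^esub> x \<and> tgt A (r a x) = tgt A a \<otimes>\<^bsub>P\<^esub> x) \<and>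
     (\<forall>a\<in>arr A. l \<one>\<^bsub>P\<^esub> a = a \<and> r a \<one>\<^bsub>P\<^esub> = a) \<and>
     (\<forall>x\<in>carrier P. \<forall>y\<in>carrier P. \<forall>a\<in>arr A.
        l (x \<otimes>\<^bsub>P\<^esub> y) a = l x (l y a) \<and> r a (x \<otimes>\<^bsub>P\<^esub> y) = r (r a x) y \<and>
        l x (r a y) = r (l x a) y) \<and>
     (\<forall>x\<in>carrier P. \<forall>a\<in>arr A. \<forall>b\<in>arr A. tgt A a = src A b \<longrightarrow>
        l x (a \<boxplus>\<^bsub>A\<^esub> b) = l x a \<boxplus>\<^bsub>A\<^esub> l x b \<and> r (a \<boxplus>\<^bsub>A\<^esub> b) x = r a x \<boxplus>\<^bsub>A\<^esub> r b x)"

definition regular_xmod :: "('p, 'a, 'b) bxmod \<Rightarrow> bool" where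
  "regular_xmod A \<longleftrightarrow> (let P = grp A; X = xm A; A1 = base X; A2 = fib X in
     group P \<and> crossed_module X \<and> obj A1 = carrier P \<and>
     biaction P A1 (lact1 A) (ract1 A) \<and> biaction P A2 (lact2 A) (ract2 A) \<and>
     (\<forall>x\<in>carrier P. \<forall>c\<in>arr A2. bd X (lact2 A x c) = lact1 A x (bd X c) \<and>
        bd X (ract2 A c x) = ract1 A (bd X c) x) \<and>
     (\<forall>z\<in>carrier P. \<forall>c\<in>arr A2. \<forall>a\<in>arr A1. tgt A2 c = src A1 a \<longrightarrow>
        lact2 A z (c \<star>\<^bsub>X\<^esub> a) = lact2 A z c \<star>\<^bsub>X\<^esub> lact1 A z a \<and>
        ract2 A (c \<star>\<^bsub>X\<^esub> a) z = ract2 A c z \<star>\<^bsub>X\<^esub> ract1 A a z))"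

definition braided_regular :: "('p, 'a, 'b) bxmod \<Rightarrow> bool" where
  "braided_regular A \<longleftrightarrow> regular_xmod A \<and>
    (let P = grp A; X = xm A; A1 = base X; A2 = fib X; e = \<one>\<^bsub>P\<^esub>;
         l1 = lact1 A; r1 = ract1 A; l2 = lact2 A; r2 = ract2 A; br = brd A in
     (\<forall>a\<in>arr A1. \<forall>b\<in>arr A1.
        br a b \<in> arr A2 \<and> tgt A2 (br a b) = tgt A1 a \<otimes>\<^bsub>P\<^esub> tgt A1 b) \<and>
     (\<forall>b\<in>arr A1. br (idt A1 e) b = idt A2 (tgt A1 b)) \<and>
     (\<forall>a\<in>arr A1. br a (idt A1 e) = idt A2 (tgt A1 a)) \<and>
     (\<forall>a\<in>arr A1. \<forall>b\<in>arr A1. \<forall>b'\<in>arr A1. tgt A1 b = src A1 b' \<longrightarrow>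
        br a (b \<boxplus>\<^bsub>A1\<^esub> b') = br a b \<star>\<^bsub>X\<^esub> l1 (tgt A1 a) b' \<boxplus>\<^bsub>A2\<^esub> br a b') \<and>
     (\<forall>a\<in>arr A1. \<forall>a'\<in>arr A1. \<forall>b\<in>arr A1. tgt A1 a = src A1 a' \<longrightarrow>
        br (a \<boxplus>\<^bsub>A1\<^esub> a') b = br a' b \<boxplus>\<^bsub>A2\<^esub> br a b \<star>\<^bsub>X\<^esub> r1 a' (tgt A1 b)) \<and>
     (\<forall>a\<in>arr A1. \<forall>b\<in>arr A1.
        bd X (br a b) = \<boxminus>\<^bsub>A1\<^esub> l1 (tgt A1 a) b \<boxplus>\<^bsub>A1\<^esub> \<boxminus>\<^bsub>A1\<^esub> r1 a (src A1 b) \<boxplus>\<^bsub>A1\<^esub>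
          l1 (src A1 a) b \<boxplus>\<^bsub>A1\<^esub> r1 a (tgt A1 b)) \<and>
     (\<forall>a\<in>arr A1. \<forall>c\<in>arr A2.
        br a (bd X c) = \<boxminus>\<^bsub>A2\<^esub> l2 (tgt A1 a) c \<boxplus>\<^bsub>A2\<^esub> l2 (src A1 a) c \<star>\<^bsub>X\<^esub> r1 a (tgt A2 c)) \<and>
     (\<forall>c\<in>arr A2. \<forall>b\<in>arr A1.
        br (bd X c) b = \<boxminus>\<^bsub>A2\<^esub> (r2 c (src A1 b) \<star>\<^bsub>X\<^esub> l1 (tgt A2 c) b) \<boxplus>\<^bsub>A2\<^esub> r2 c (tgt A1 b)) \<and>
     (\<forall>x\<in>carrier P. \<forall>a\<in>arr A1. \<forall>b\<in>arr A1.
        l2 x (br a b) = br (l1 x a) b \<and> r2 (br a b) x = br a (r1 b x) \<and>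
        br (r1 a x) b = br a (l1 x b)))"

definition AUT_1 :: "('x, 'g, 'c, 'm) xmod_scheme \<Rightarrow>
    (('x, 'g, 'c) xmor, ('x, 'g, 'c) htpy) groupoid" where
  "AUT_1 X = (let G = base X; C = fib X in \<lparr>
     obj = carrier (Aut X),
     arr = {s. homotopy X s \<and> hbase s \<in> carrier (Aut X) \<and> hsource X s \<in> carrier (Aut X)},
     src = hsource X,
     tgt = hbase,
     add = (\<lambda>s t. \<lparr>h0 = (\<lambda>x\<in>obj G. h0 s x \<boxplus>\<^bsub>G\<^esub> h0 t x),
                   h1 = (\<lambda>a\<in>arr G. h1 t a \<boxplus>\<^bsub>C\<^esub> h1 s a \<star>\<^bsub>X\<^esub> h0 t (tgt G a)),
                   hbase = hbase t\<rparr>),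
     idt = (\<lambda>f. \<lparr>h0 = (\<lambda>x\<in>obj G. idt G (m0 f x)),
                 h1 = (\<lambda>a\<in>arr G. idt C (tgt G (m1 f a))),
                 hbase = f\<rparr>)\<rparr>)"

definition AUT_2 :: "('x, 'g, 'c, 'm) xmod_scheme \<Rightarrow>
    (('x, 'g, 'c) xmor, ('x \<Rightarrow> 'c) \<times> ('x, 'g, 'c) xmor) groupoid" where
  "AUT_2 X = (let C = fib X in \<lparr>
     obj = carrier (Aut X),
     arr = {(s, f). f \<in> carrier (Aut X) \<and> s \<in> objs X \<rightarrow>\<^sub>E arr C \<and>
                    (\<forall>x\<in>objs X. tgt C (s x) = m0 f x)},
     src = snd,
     tgt = snd,
     add = (\<lambda>(s, f) (t, f'). (\<lambda>x\<in>objs X. s x \<boxplus>\<^bsub>C\<^esub> t x, f)),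
     idt = (\<lambda>f. (\<lambda>x\<in>objs X. idt C (m0 f x), f))\<rparr>)"

definition AUT_xmod :: "('x, 'g, 'c, 'm) xmod_scheme \<Rightarrow>
    (('x, 'g, 'c) xmor, ('x, 'g, 'c) htpy, ('x \<Rightarrow> 'c) \<times> ('x, 'g, 'c) xmor) xmod" where
  "AUT_xmod X = (let G = base X; C = fib X in \<lparr>
     base = AUT_1 X,
     fib = AUT_2 X,
     bd = (\<lambda>(s, f). \<lparr>
       h0 = (\<lambda>x\<in>obj G. bd X (s x)),
       h1 = (\<lambda>a\<in>arr G. \<boxminus>\<^bsub>C\<^esub> (s (src G a) \<star>\<^bsub>X\<^esub> m1 f a) \<boxplus>\<^bsub>C\<^esub> s (tgt G a)),
       hbase = f\<rparr>),
     act = (\<lambda>(s, f) t. (\<lambda>x\<in>obj G. s x \<star>\<^bsub>X\<^esub> h0 t x, hbase t))\<rparr>)"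

definition AUT :: "('x, 'g, 'c, 'm) xmod_scheme \<Rightarrow>
    (('x, 'g, 'c) xmor, ('x, 'g, 'c) htpy, ('x \<Rightarrow> 'c) \<times> ('x, 'g, 'c) xmor) bxmod" where
  "AUT X = (let O\<^sub>X = objs X; G\<^sub>X = arr (base X) in \<lparr>
     grp = Aut X,
     xm = AUT_xmod X,
     lact1 = (\<lambda>h s. \<lparr>h0 = compose O\<^sub>X (m1 h) (h0 s), h1 = compose G\<^sub>X (m2 h) (h1 s),
                     hbase = h \<otimes>\<^bsub>Aut X\<^esub> hbase s\<rparr>),
     ract1 = (\<lambda>s h. \<lparr>h0 = compose O\<^sub>X (h0 s) (m0 h), h1 = compose G\<^sub>X (h1 s) (m1 h),
                     hbase = hbase s \<otimes>\<^bsub>Aut X\<^esub> h\<rparr>),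
     lact2 = (\<lambda>h (s, f). (compose O\<^sub>X (m2 h) s, h \<otimes>\<^bsub>Aut X\<^esub> f)),
     ract2 = (\<lambda>(s, f) h. (compose O\<^sub>X s (m0 h), f \<otimes>\<^bsub>Aut X\<^esub> h)),
     brd = (\<lambda>s t. (compose O\<^sub>X (h1 s) (h0 t), hbase s \<otimes>\<^bsub>Aut X\<^esub> hbase t))\<rparr>)"

text \<open>In $L \to M \to P$ the maps are \<open>dL\<close>, \<open>dM\<close>; \<open>actLP\<close>, \<open>actMP\<close>, \<open>actLM\<close> are the right
  actions of \<open>P\<close> on \<open>L\<close>, of \<open>P\<close> on \<open>M\<close> and of \<open>M\<close> on \<open>L\<close>.\<close>

record ('l, 'm, 'p) xmod2 =
  gL :: "'l monoid"
  gM :: "'m monoid"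
  gP :: "'p monoid"
  dL :: "'l \<Rightarrow> 'm"
  dM :: "'m \<Rightarrow> 'p"
  actLP :: "'l \<Rightarrow> 'p \<Rightarrow> 'l"
  actMP :: "'m \<Rightarrow> 'p \<Rightarrow> 'm"
  actLM :: "'l \<Rightarrow> 'm \<Rightarrow> 'l"
  plift :: "'m \<Rightarrow> 'm \<Rightarrow> 'l"

text \<open>Right action of \<open>H\<close> on \<open>N\<close> by group automorphisms (bijectivity follows from the action laws).\<close>

definition group_acts :: "'h monoid \<Rightarrow> 'n monoid \<Rightarrow> ('n \<Rightarrow> 'h \<Rightarrow> 'n) \<Rightarrow> bool" where
  "group_acts H N \<phi> \<longleftrightarrow>
     (\<forall>n\<in>carrier N. \<forall>h\<in>carrier H. \<phi> n h \<in> carrier N) \<and>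
     (\<forall>n\<in>carrier N. \<forall>n'\<in>carrier N. \<forall>h\<in>carrier H. \<phi> (n \<otimes>\<^bsub>N\<^esub> n') h = \<phi> n h \<otimes>\<^bsub>N\<^esub> \<phi> n' h) \<and>
     (\<forall>n\<in>carrier N. \<phi> n \<one>\<^bsub>H\<^esub> = n) \<and>
     (\<forall>n\<in>carrier N. \<forall>h\<in>carrier H. \<forall>k\<in>carrier H. \<phi> n (h \<otimes>\<^bsub>H\<^esub> k) = \<phi> (\<phi> n h) k)"

definition group_crossed_module ::
  "'n monoid \<Rightarrow> 'h monoid \<Rightarrow> ('n \<Rightarrow> 'h) \<Rightarrow> ('n \<Rightarrow> 'h \<Rightarrow> 'n) \<Rightarrow> bool" where
  "group_crossed_module N H d \<phi> \<longleftrightarrow>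
     group N \<and> group H \<and> d \<in> hom N H \<and> group_acts H N \<phi> \<and>
     (\<forall>n\<in>carrier N. \<forall>h\<in>carrier H. d (\<phi> n h) = inv\<^bsub>H\<^esub> h \<otimes>\<^bsub>H\<^esub> d n \<otimes>\<^bsub>H\<^esub> h) \<and>
     (\<forall>n\<in>carrier N. \<forall>n'\<in>carrier N. \<phi> n (d n') = inv\<^bsub>N\<^esub> n' \<otimes>\<^bsub>N\<^esub> n \<otimes>\<^bsub>N\<^esub> n')"

definition two_crossed_module :: "('l, 'm, 'p) xmod2 \<Rightarrow> bool" where
  "two_crossed_module T \<longleftrightarrow>
    (let L = gL T; M = gM T; P = gP T; pl = plift T in
     group L \<and> group M \<and> group P \<and> dL T \<in> hom L M \<and> dM T \<in> hom M P \<and>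
     (\<forall>l\<in>carrier L. dM T (dL T l) = \<one>\<^bsub>P\<^esub>) \<and>
     group_acts P L (actLP T) \<and> group_acts P M (actMP T) \<and>
     (\<forall>l\<in>carrier L. \<forall>p\<in>carrier P. dL T (actLP T l p) = actMP T (dL T l) p) \<and>
     (\<forall>m\<in>carrier M. \<forall>p\<in>carrier P. dM T (actMP T m p) = inv\<^bsub>P\<^esub> p \<otimes>\<^bsub>P\<^esub> dM T m \<otimes>\<^bsub>P\<^esub> p) \<and>
     group_crossed_module L M (dL T) (actLM T) \<and>
     (\<forall>l\<in>carrier L. \<forall>m\<in>carrier M. \<forall>p\<in>carrier P.
        actLP T (actLM T l m) p = actLM T (actLP T l p) (actMP T m p)) \<and>
     (\<forall>m\<in>carrier M. \<forall>m'\<in>carrier M. pl m m' \<in> carrier L) \<and>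
     (\<forall>m\<in>carrier M. \<forall>m'\<in>carrier M.
        dL T (pl m m') = inv\<^bsub>M\<^esub> m \<otimes>\<^bsub>M\<^esub> inv\<^bsub>M\<^esub> m' \<otimes>\<^bsub>M\<^esub> m \<otimes>\<^bsub>M\<^esub> actMP T m' (dM T m)) \<and>
     (\<forall>l\<in>carrier L. \<forall>m\<in>carrier M.
        pl (dL T l) m = inv\<^bsub>L\<^esub> l \<otimes>\<^bsub>L\<^esub> actLM T l m \<and>
        pl m (dL T l) = inv\<^bsub>L\<^esub> (actLM T l m) \<otimes>\<^bsub>L\<^esub> actLP T l (dM T m)) \<and>
     (\<forall>m\<in>carrier M. \<forall>n\<in>carrier M. \<forall>k\<in>carrier M.
        pl m (n \<otimes>\<^bsub>M\<^esub> k) = pl m k \<otimes>\<^bsub>L\<^esub> actLM T (pl m n) (actMP T k (dM T m)) \<and>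
        pl (m \<otimes>\<^bsub>M\<^esub> n) k = actLM T (pl m k) n \<otimes>\<^bsub>L\<^esub> pl n (actMP T k (dM T m))) \<and>
     (\<forall>m\<in>carrier M. \<forall>m'\<in>carrier M. \<forall>p\<in>carrier P.
        actLP T (pl m m') p = pl (actMP T m p) (actMP T m' p)))"

definition xmod2_iso :: "('l, 'm, 'p) xmod2 \<Rightarrow> ('l', 'm', 'p') xmod2 \<Rightarrow>
    ('l \<Rightarrow> 'l') \<Rightarrow> ('m \<Rightarrow> 'm') \<Rightarrow> ('p \<Rightarrow> 'p') \<Rightarrow> bool" where
  "xmod2_iso T T' \<phi>\<^sub>L \<phi>\<^sub>M \<phi>\<^sub>P \<longleftrightarrow>
     \<phi>\<^sub>L \<in> iso (gL T) (gL T') \<and> \<phi>\<^sub>M \<in> iso (gM T) (gM T') \<and> \<phi>\<^sub>P \<in> iso (gP T) (gP T') \<and>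
     (\<forall>l\<in>carrier (gL T). dL T' (\<phi>\<^sub>L l) = \<phi>\<^sub>M (dL T l)) \<and>
     (\<forall>m\<in>carrier (gM T). dM T' (\<phi>\<^sub>M m) = \<phi>\<^sub>P (dM T m)) \<and>
     (\<forall>l\<in>carrier (gL T). \<forall>p\<in>carrier (gP T). actLP T' (\<phi>\<^sub>L l) (\<phi>\<^sub>P p) = \<phi>\<^sub>L (actLP T l p)) \<and>
     (\<forall>m\<in>carrier (gM T). \<forall>p\<in>carrier (gP T). actMP T' (\<phi>\<^sub>M m) (\<phi>\<^sub>P p) = \<phi>\<^sub>M (actMP T m p)) \<and>
     (\<forall>l\<in>carrier (gL T). \<forall>m\<in>carrier (gM T). actLM T' (\<phi>\<^sub>L l) (\<phi>\<^sub>M m) = \<phi>\<^sub>L (actLM T l m)) \<and>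
     (\<forall>m\<in>carrier (gM T). \<forall>m'\<in>carrier (gM T). plift T' (\<phi>\<^sub>M m) (\<phi>\<^sub>M m') = \<phi>\<^sub>L (plift T m m'))"

definition loop_group :: "('p, 'a, 'b) bxmod \<Rightarrow> 'b monoid" where
  "loop_group A = (let A2 = fib (xm A); e = \<one>\<^bsub>grp A\<^esub> in
     \<lparr>carrier = {c \<in> arr A2. tgt A2 c = e}, mult = add A2, one = idt A2 e\<rparr>)"

definition star_group :: "('p, 'a, 'b) bxmod \<Rightarrow> 'a monoid" where
  "star_group A = (let A1 = base (xm A); e = \<one>\<^bsub>grp A\<^esub> in
     \<lparr>carrier = {a \<in> arr A1. tgt A1 a = e},
      mult = (\<lambda>a b. ract1 A a (src A1 b) \<boxplus>\<^bsub>A1\<^esub> b),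
      one = idt A1 e\<rparr>)"

definition star_act :: "('p, 'a, 'b) bxmod \<Rightarrow> 'b \<Rightarrow> 'a \<Rightarrow> 'b" where
  "star_act A c a = ract2 A c (src (base (xm A)) a) \<star>\<^bsub>xm A\<^esub> a"

definition assoc_xmod2 :: "('p, 'a, 'b) bxmod \<Rightarrow> ('b, 'a, 'p) xmod2" where
  "assoc_xmod2 A = (let P = grp A; K = star_group A in \<lparr>
     gL = loop_group A, gM = K, gP = P,
     dL = bd (xm A),
     dM = src (base (xm A)),
     actLP = (\<lambda>c p. ract2 A (lact2 A (inv\<^bsub>P\<^esub> p) c) p),
     actMP = (\<lambda>a p. ract1 A (lact1 A (inv\<^bsub>P\<^esub> p) a) p),
     actLM = star_act A,
     plift = (\<lambda>a b. star_act A (brd A (inv\<^bsub>K\<^esub> a) b) a)\<rparr>)"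

text \<open>The sequence $M_2(C) \to FDer^*(C) \to Aut(C)$ with its actions, and with \<open>pl\<close> as the
  Peiffer lifting; a given isomorphism onto another 2-crossed module determines \<open>pl\<close>.\<close>

definition der_sequence :: "('x, 'g, 'c, 'm) xmod_scheme \<Rightarrow>
    (('x \<Rightarrow> 'g) \<times> ('g \<Rightarrow> 'c) \<Rightarrow> ('x \<Rightarrow> 'g) \<times> ('g \<Rightarrow> 'c) \<Rightarrow> ('x \<Rightarrow> 'c)) \<Rightarrow>
    ('x \<Rightarrow> 'c, ('x \<Rightarrow> 'g) \<times> ('g \<Rightarrow> 'c), ('x, 'g, 'c) xmor) xmod2" where
  "der_sequence X pl = \<lparr>
     gL = M2 X, gM = FDer_units X, gP = Aut X,
     dL = zeta X,
     dM = Delta X,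
     actLP = Aut_on_M2 X,
     actMP = Aut_on_FDer X,
     actLM = FDer_on_M2 X,
     plift = pl\<rparr>"

end

theory Submission
  imports Defs
begin

text \<open>
  A homotopy \<open>s\<close> on \<open>f\<close> is determined by \<open>s\<^sub>0\<close>, \<open>s\<^sub>1\<close> and \<open>f\<close>, and the structure of $AUT(C)$ is
  pointwise, so every axiom is an equation between words in the groupoids \<open>G\<close> and \<open>C\<close>. Such
  equations are decided by rewriting: homomorphisms, derivations and actions are pushed to the
  generators and the resulting free words are cancelled. For an abstract braided regular crossed
  module the same rewriting, together with the braiding axioms read as rules that expand
  \<open>{ , }\<close> on sums, inverses and translates, gives the 2-crossed module axioms. Finally, taking
  sources turns the multiplication of free derivations into composition, so a free derivation \<open>s\<close>
  is a unit iff \<open>\<Delta>(s)\<close> is an automorphism: its inverse in \<open>K\<close> then is an inverse free derivation.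
  This identifies $FDer^*(C)$ with \<open>K\<close>, and the structure of the associated 2-crossed module is
  transported along the identification.
\<close>

section \<open>Groupoids and crossed modules\<close>

context groupoid
begin

text \<open>Makes the definite description in \<open>neg\<close> denote: b = b + (a + c) = (b + a) +
  c = c.\<close>

lemma is_neg_unique:
  assumes "a \<in> arr G" "is_neg G a b" "is_neg G a c"
  shows "b = c"
proof -
  have "b = b \<boxplus> (a \<boxplus> c)"
    using assms add_idt[of b] by (auto simp: is_neg_def)
  also have "\<dots> = (b \<boxplus> a) \<boxplus> c"
    using assms by (intro add_assoc[symmetric]) (auto simp: is_neg_def)
  also have "\<dots> = c"
    using assms idt_add[of c] by (auto simp: is_neg_def)
  finally show ?thesis .
qed

lemma is_neg_neg: "a \<in> arr G \<Longrightarrow> is_neg G a (\<boxminus> a)"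
  unfolding neg_def using neg_ex is_neg_unique by (metis theI)

lemma neg_eqI: "\<lbrakk>a \<in> arr G; is_neg G a b\<rbrakk> \<Longrightarrow> \<boxminus> a = b"
  using is_neg_neg is_neg_unique by blast

lemma neg_closed: "a \<in> arr G \<Longrightarrow> \<boxminus> a \<in> arr G"
  and src_neg: "a \<in> arr G \<Longrightarrow> src G (\<boxminus> a) = tgt G a"
  and tgt_neg: "a \<in> arr G \<Longrightarrow> tgt G (\<boxminus> a) = src G a"
  and add_neg: "a \<in> arr G \<Longrightarrow> a \<boxplus> \<boxminus> a = idt G (src G a)"
  and neg_add: "a \<in> arr G \<Longrightarrow> \<boxminus> a \<boxplus> a = idt G (tgt G a)"
  using is_neg_neg by (simp_all add: is_neg_def)

text \<open>The object of the identity is a variable tied by a premise, so that the laws still match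
  after \<open>src G a\<close> or \<open>tgt G a\<close> has been simplified.\<close>

lemma idt_add_eq: "\<lbrakk>a \<in> arr G; x = src G a\<rbrakk> \<Longrightarrow> idt G x \<boxplus> a = a"
  and add_idt_eq: "\<lbrakk>a \<in> arr G; x = tgt G a\<rbrakk> \<Longrightarrow> a \<boxplus> idt G x = a"
  by (simp_all add: idt_add add_idt)

lemma add_neg_cancel: "\<lbrakk>a \<in> arr G; b \<in> arr G; src G a = src G b\<rbrakk> \<Longrightarrow> a \<boxplus> (\<boxminus> a \<boxplus> b) = b"
  by (simp add: add_assoc[symmetric] neg_closed src_neg tgt_neg add_neg idt_add)

lemma neg_add_cancel: "\<lbrakk>a \<in> arr G; b \<in> arr G; tgt G a = src G b\<rbrakk> \<Longrightarrow> \<boxminus> a \<boxplus> (a \<boxplus> b) = b"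
  by (simp add: add_assoc[symmetric] neg_closed src_neg tgt_neg neg_add idt_add)

lemma neg_neg: "a \<in> arr G \<Longrightarrow> \<boxminus> (\<boxminus> a) = a"
  by (rule neg_eqI) (simp_all add: is_neg_def neg_closed src_neg tgt_neg add_neg neg_add)

lemma neg_idt: "x \<in> obj G \<Longrightarrow> \<boxminus> (idt G x) = idt G x"
  using idt_add[of "idt G x"]
  by (intro neg_eqI) (simp_all add: is_neg_def idt_closed src_idt tgt_idt)

lemma neg_sum: "\<lbrakk>a \<in> arr G; b \<in> arr G; tgt G a = src G b\<rbrakk> \<Longrightarrow> \<boxminus> (a \<boxplus> b) = \<boxminus> b \<boxplus> \<boxminus> a"
  by (rule neg_eqI)
     (simp_all add: is_neg_def add_closed src_add tgt_add add_assoc neg_closed src_neg tgt_neg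
       add_neg_cancel neg_add_cancel add_neg neg_add)

text \<open>The rules for sums, identities and inverses are the ten rules of the Knuth-Bendix
  completion of the group axioms, conditional on composability; the others discharge these
  conditions. Words are thereby brought to right-nested reduced form.\<close>

lemmas groupoid_simps =
  src_closed tgt_closed add_closed src_add tgt_add add_assoc idt_closed src_idt tgt_idt
  idt_add_eq add_idt_eq neg_closed src_neg tgt_neg add_neg neg_add add_neg_cancel neg_add_cancel
  neg_neg neg_idt neg_sum

text \<open>A map that respects sums sends an identity to an idempotent loop; morphisms, actions and
  derivations are shown to preserve identities in this way. The proof cancels \<open>a\<close> from
  \<open>a \<boxplus> a = a\<close>.\<close>

lemma idempotent_imp_idt:
  assumes "a \<in> arr G" "src G a = tgt G a" "a \<boxplus> a = a"
  shows "a = idt G (tgt G a)"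
  using neg_add_cancel[of a a] assms by (simp add: neg_add)

text \<open>A left inverse suffices: add \<open>\<boxminus> a\<close> on the right. Preservation of
  inverses then needs only one equation.\<close>

lemma neg_eqI': 
  assumes "a \<in> arr G" "b \<in> arr G" "src G b = tgt G a" "tgt G b = src G a"
    "b \<boxplus> a = idt G (tgt G a)"
  shows "b = \<boxminus> a"
proof -
  have "b = (b \<boxplus> a) \<boxplus> \<boxminus> a"
    using assms(1-4) by (simp add: groupoid_simps)
  also have "\<dots> = \<boxminus> a"
    unfolding assms(5) using assms(1-4) by (simp add: groupoid_simps)
  finally show ?thesis .
qed

end

lemma groupoid_hom_closed:
  assumes "groupoid_hom G H f0 f1"
  shows "x \<in> obj G \<Longrightarrow> f0 x \<in> obj H" "a \<in> arr G \<Longrightarrow> f1 a \<in> arr H"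
    "a \<in> arr G \<Longrightarrow> src H (f1 a) = f0 (src G a)" "a \<in> arr G \<Longrightarrow> tgt H (f1 a) = f0 (tgt G a)"
    "\<lbrakk>a \<in> arr G; b \<in> arr G; tgt G a = src G b\<rbrakk> \<Longrightarrow> f1 (a \<boxplus>\<^bsub>G\<^esub> b) = f1 a \<boxplus>\<^bsub>H\<^esub> f1 b"
  using assms by (auto simp: groupoid_hom_def)

text \<open>\<open>groupoid_hom\<close> demands additivity only. The image of an identity is an
  idempotent loop, and the image of -a is a left inverse of the image of a.\<close>

lemma groupoid_hom_idt_neg:
  assumes "groupoid G" "groupoid H" "groupoid_hom G H f0 f1"
  shows "x \<in> obj G \<Longrightarrow> f1 (idt G x) = idt H (f0 x)"
    "a \<in> arr G \<Longrightarrow> f1 (\<boxminus>\<^bsub>G\<^esub> a) = \<boxminus>\<^bsub>H\<^esub> f1 a"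
proof -
  interpret G: groupoid G by fact
  interpret H: groupoid H by fact
  note h = groupoid_hom_closed[OF assms(3)]
  show i: "f1 (idt G x) = idt H (f0 x)" if "x \<in> obj G" for x
    using that H.idempotent_imp_idt[of "f1 (idt G x)"] h(5)[of "idt G x" "idt G x"]
    by (simp add: h G.groupoid_simps)
  show "f1 (\<boxminus>\<^bsub>G\<^esub> a) = \<boxminus>\<^bsub>H\<^esub> f1 a" if "a \<in> arr G"
    using that h(5)[of "\<boxminus>\<^bsub>G\<^esub> a" a]
    by (intro H.neg_eqI') (simp_all add: h i G.groupoid_simps)
qed

section \<open>Words in a crossed module of groupoids\<close>

context crossed_module
begin

sublocale base: groupoid G
  by (rule base_groupoid)

sublocale fib: groupoid C
  by (rule fib_groupoid)

lemma src_bd_tgt: "c \<in> arr C \<Longrightarrow> src G (bd X c) = tgt C c"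
  by (simp add: src_bd tot_intrans)

lemma tgt_fib_obj: "c \<in> arr C \<Longrightarrow> tgt C c \<in> obj G"
  using fib.tgt_closed same_obj by simp

text \<open>Acting by \<open>a\<close> is additive, so it sends the identity to an idempotent
  loop.\<close>

lemma idt_act: 
  assumes "a \<in> arr G" "x = src G a"
  shows "idt C x \<star> a = idt C (tgt G a)"
proof -
  let ?i = "idt C x"
  have x: "x \<in> obj C" using assms base.src_closed same_obj by simp
  have i: "?i \<in> arr C" "tgt C ?i = x" using x by (auto simp: fib.groupoid_simps)
  have "?i \<star> a \<boxplus>\<^bsub>C\<^esub> ?i \<star> a = (?i \<boxplus>\<^bsub>C\<^esub> ?i) \<star> a"
    using i assms by (simp add: add_act)
  also have "?i \<boxplus>\<^bsub>C\<^esub> ?i = ?i" using x by (simp add: fib.groupoid_simps)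
  finally show ?thesis
    using fib.idempotent_imp_idt[of "?i \<star> a"] i assms by (simp add: act_closed tgt_act tot_intrans)
qed

lemma neg_act:
  assumes "c \<in> arr C" "a \<in> arr G" "tgt C c = src G a"
  shows "(\<boxminus>\<^bsub>C\<^esub> c) \<star> a = \<boxminus>\<^bsub>C\<^esub> (c \<star> a)"
  using assms add_act[of "\<boxminus>\<^bsub>C\<^esub> c" c a]
  by (intro fib.neg_eqI') (simp_all add: fib.groupoid_simps act_closed tgt_act tot_intrans idt_act)

lemma act_neg_cancel:
  assumes "c \<in> arr C" "a \<in> arr G" 
  shows "tgt C c = src G a \<Longrightarrow> (c \<star> a) \<star> \<boxminus>\<^bsub>G\<^esub> a = c"
    "tgt C c = tgt G a \<Longrightarrow> (c \<star> \<boxminus>\<^bsub>G\<^esub> a) \<star> a = c"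
  using assms act_idt[of c] by (simp_all add: act_add[symmetric] base.groupoid_simps)

lemma act_idt_eq: "\<lbrakk>c \<in> arr C; x = tgt C c\<rbrakk> \<Longrightarrow> c \<star> idt G x = c"
  by (simp add: act_idt)

text \<open>\<open>groupoid_hom\<close> concerns extensional maps, while \<open>bd X\<close> is
  unconstrained outside \<open>arr C\<close>. Its restriction is the morphism from which
  \<open>bd_idt\<close> and \<open>bd_neg\<close> are read off.\<close>

lemma bd_hom: "groupoid_hom C G (\<lambda>x\<in>obj C. x) (restrict (bd X) (arr C))"
  using fib.src_closed fib.tgt_closed
  by (auto simp: groupoid_hom_def bd_closed src_bd tgt_bd bd_add fib.add_closed same_obj)

lemma bd_idt: "x \<in> obj G \<Longrightarrow> bd X (idt C x) = idt G x"
  and bd_neg: "c \<in> arr C \<Longrightarrow> bd X (\<boxminus>\<^bsub>C\<^esub> c) = \<boxminus>\<^bsub>G\<^esub> bd X c"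
  using groupoid_hom_idt_neg[OF fib_groupoid base_groupoid bd_hom]
  by (auto simp: same_obj fib.groupoid_simps)

text \<open>As C is totally intransitive, composability can be expressed through targets alone, and
  \<open>src C\<close> disappears from the side conditions.\<close>

lemma fib_rules:
  "\<lbrakk>c \<in> arr C; d \<in> arr C; tgt C c = tgt C d\<rbrakk> \<Longrightarrow> c \<boxplus>\<^bsub>C\<^esub> d \<in> arr C"
  "\<lbrakk>c \<in> arr C; d \<in> arr C; tgt C c = tgt C d\<rbrakk> \<Longrightarrow> tgt C (c \<boxplus>\<^bsub>C\<^esub> d) = tgt C d"
  "\<lbrakk>c \<in> arr C; d \<in> arr C; e \<in> arr C; tgt C c = tgt C d; tgt C d = tgt C e\<rbrakk>
     \<Longrightarrow> (c \<boxplus>\<^bsub>C\<^esub> d) \<boxplus>\<^bsub>C\<^esub> e = c \<boxplus>\<^bsub>C\<^esub> (d \<boxplus>\<^bsub>C\<^esub> e)"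
  "x \<in> obj G \<Longrightarrow> idt C x \<in> arr C"
  "x \<in> obj G \<Longrightarrow> tgt C (idt C x) = x"
  "\<lbrakk>c \<in> arr C; x = tgt C c\<rbrakk> \<Longrightarrow> idt C x \<boxplus>\<^bsub>C\<^esub> c = c"
  "\<lbrakk>c \<in> arr C; x = tgt C c\<rbrakk> \<Longrightarrow> c \<boxplus>\<^bsub>C\<^esub> idt C x = c"
  "c \<in> arr C \<Longrightarrow> \<boxminus>\<^bsub>C\<^esub> c \<in> arr C"
  "c \<in> arr C \<Longrightarrow> tgt C (\<boxminus>\<^bsub>C\<^esub> c) = tgt C c"
  "c \<in> arr C \<Longrightarrow> c \<boxplus>\<^bsub>C\<^esub> \<boxminus>\<^bsub>C\<^esub> c = idt C (tgt C c)"
  "c \<in> arr C \<Longrightarrow> \<boxminus>\<^bsub>C\<^esub> c \<boxplus>\<^bsub>C\<^esub> c = idt C (tgt C c)"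
  "\<lbrakk>c \<in> arr C; d \<in> arr C; tgt C c = tgt C d\<rbrakk> \<Longrightarrow> c \<boxplus>\<^bsub>C\<^esub> (\<boxminus>\<^bsub>C\<^esub> c \<boxplus>\<^bsub>C\<^esub> d) = d"
  "\<lbrakk>c \<in> arr C; d \<in> arr C; tgt C c = tgt C d\<rbrakk> \<Longrightarrow> \<boxminus>\<^bsub>C\<^esub> c \<boxplus>\<^bsub>C\<^esub> (c \<boxplus>\<^bsub>C\<^esub> d) = d"
  "c \<in> arr C \<Longrightarrow> \<boxminus>\<^bsub>C\<^esub> (\<boxminus>\<^bsub>C\<^esub> c) = c"
  "x \<in> obj G \<Longrightarrow> \<boxminus>\<^bsub>C\<^esub> (idt C x) = idt C x"
  "\<lbrakk>c \<in> arr C; d \<in> arr C; tgt C c = tgt C d\<rbrakk> \<Longrightarrow> \<boxminus>\<^bsub>C\<^esub> (c \<boxplus>\<^bsub>C\<^esub> d) = \<boxminus>\<^bsub>C\<^esub> d \<boxplus>\<^bsub>C\<^esub> \<boxminus>\<^bsub>C\<^esub> c"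
  "\<lbrakk>c \<in> arr C; d \<in> arr C; tgt C c = tgt C d\<rbrakk>
     \<Longrightarrow> bd X (c \<boxplus>\<^bsub>C\<^esub> d) = bd X c \<boxplus>\<^bsub>G\<^esub> bd X d"
  by (simp_all add: tot_intrans same_obj fib.groupoid_simps bd_add)

text \<open>\<open>bd_neg\<close> moves an inverse out of \<delta>, where \<open>act_bd\<close> no
  longer matches; this is the Peiffer rule for exponents of that shape.\<close>

lemma act_neg_bd:
  assumes "c \<in> arr C" "d \<in> arr C" "tgt C c = tgt C d"
  shows "c \<star> \<boxminus>\<^bsub>G\<^esub> bd X d = d \<boxplus>\<^bsub>C\<^esub> c \<boxplus>\<^bsub>C\<^esub> \<boxminus>\<^bsub>C\<^esub> d"
  using assms act_bd[of c "\<boxminus>\<^bsub>C\<^esub> d"] by (simp add: fib_rules bd_neg)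

lemmas xmod_simps = base.groupoid_simps fib_rules tgt_fib_obj
  bd_closed src_bd_tgt tgt_bd bd_idt bd_neg bd_act
  act_closed tgt_act add_act act_add act_bd act_neg_bd idt_act neg_act act_neg_cancel act_idt_eq

end

section \<open>Endomorphisms and homotopies\<close>

context crossed_module
begin

section \<open>Endomorphisms and the automorphism group\<close>

lemma xendD:
  assumes "f \<in> xend X"
  shows "groupoid_hom G G (m0 f) (m1 f)" "groupoid_hom C C (m0 f) (m2 f)"
    "c \<in> arr C \<Longrightarrow> m1 f (bd X c) = bd X (m2 f c)"
    "\<lbrakk>c \<in> arr C; a \<in> arr G; tgt C c = src G a\<rbrakk> \<Longrightarrow> m2 f (c \<star> a) = m2 f c \<star> m1 f a"
  using assms by (simp_all add: xend_def G_def C_def)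

lemma xend_rules:
  assumes "f \<in> xend X"
  shows "x \<in> obj G \<Longrightarrow> m0 f x \<in> obj G"
    "a \<in> arr G \<Longrightarrow> m1 f a \<in> arr G"
    "a \<in> arr G \<Longrightarrow> src G (m1 f a) = m0 f (src G a)"
    "a \<in> arr G \<Longrightarrow> tgt G (m1 f a) = m0 f (tgt G a)"
    "\<lbrakk>a \<in> arr G; b \<in> arr G; tgt G a = src G b\<rbrakk> \<Longrightarrow> m1 f (a \<boxplus>\<^bsub>G\<^esub> b) = m1 f a \<boxplus>\<^bsub>G\<^esub> m1 f b"
    "x \<in> obj G \<Longrightarrow> m1 f (idt G x) = idt G (m0 f x)"
    "a \<in> arr G \<Longrightarrow> m1 f (\<boxminus>\<^bsub>G\<^esub> a) = \<boxminus>\<^bsub>G\<^esub> m1 f a"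
    "c \<in> arr C \<Longrightarrow> m2 f c \<in> arr C"
    "c \<in> arr C \<Longrightarrow> tgt C (m2 f c) = m0 f (tgt C c)"
    "\<lbrakk>c \<in> arr C; d \<in> arr C; tgt C c = tgt C d\<rbrakk> \<Longrightarrow> m2 f (c \<boxplus>\<^bsub>C\<^esub> d) = m2 f c \<boxplus>\<^bsub>C\<^esub> m2 f d"
    "x \<in> obj G \<Longrightarrow> m2 f (idt C x) = idt C (m0 f x)"
    "c \<in> arr C \<Longrightarrow> m2 f (\<boxminus>\<^bsub>C\<^esub> c) = \<boxminus>\<^bsub>C\<^esub> m2 f c"
    "c \<in> arr C \<Longrightarrow> m1 f (bd X c) = bd X (m2 f c)"
    "\<lbrakk>c \<in> arr C; a \<in> arr G; tgt C c = src G a\<rbrakk> \<Longrightarrow> m2 f (c \<star> a) = m2 f c \<star> m1 f a"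
  using groupoid_hom_closed[OF xendD(1)[OF assms]] groupoid_hom_closed[OF xendD(2)[OF assms]]
    groupoid_hom_idt_neg[OF base_groupoid base_groupoid xendD(1)[OF assms]]
    groupoid_hom_idt_neg[OF fib_groupoid fib_groupoid xendD(2)[OF assms]]
    xendD(3,4)[OF assms]
  by (simp_all add: same_obj tot_intrans)

lemma xend_ext:
  assumes "f \<in> xend X"
  shows "m0 f \<in> extensional (obj G)" "m1 f \<in> extensional (arr G)" "m2 f \<in> extensional (arr C)"
  using xendD(1,2)[OF assms] by (auto simp: groupoid_hom_def PiE_def)

lemma xendI:
  assumes "m0 f \<in> extensional (obj G)" "m1 f \<in> extensional (arr G)" "m2 f \<in> extensional (arr C)"
    "\<And>x. x \<in> obj G \<Longrightarrow> m0 f x \<in> obj G"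
    "\<And>a. a \<in> arr G \<Longrightarrow> m1 f a \<in> arr G"
    "\<And>a. a \<in> arr G \<Longrightarrow> src G (m1 f a) = m0 f (src G a)"
    "\<And>a. a \<in> arr G \<Longrightarrow> tgt G (m1 f a) = m0 f (tgt G a)"
    "\<And>a b. \<lbrakk>a \<in> arr G; b \<in> arr G; tgt G a = src G b\<rbrakk> \<Longrightarrow> m1 f (a \<boxplus>\<^bsub>G\<^esub> b) = m1 f a \<boxplus>\<^bsub>G\<^esub> m1 f b"
    "\<And>c. c \<in> arr C \<Longrightarrow> m2 f c \<in> arr C"
    "\<And>c. c \<in> arr C \<Longrightarrow> tgt C (m2 f c) = m0 f (tgt C c)"
    "\<And>c d. \<lbrakk>c \<in> arr C; d \<in> arr C; tgt C c = tgt C d\<rbrakk> \<Longrightarrow> m2 f (c \<boxplus>\<^bsub>C\<^esub> d) = m2 f c \<boxplus>\<^bsub>C\<^esub> m2 f d"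
    "\<And>c. c \<in> arr C \<Longrightarrow> m1 f (bd X c) = bd X (m2 f c)"
    "\<And>c a. \<lbrakk>c \<in> arr C; a \<in> arr G; tgt C c = src G a\<rbrakk> \<Longrightarrow> m2 f (c \<star> a) = m2 f c \<star> m1 f a"
  shows "f \<in> xend X"
  using assms
  by (auto simp: xend_def groupoid_hom_def PiE_def same_obj tot_intrans simp flip: G_def C_def)

lemma xmor_eqI:
  assumes "f \<in> xend X" "g \<in> xend X"
    "\<And>x. x \<in> obj G \<Longrightarrow> m0 f x = m0 g x"
    "\<And>a. a \<in> arr G \<Longrightarrow> m1 f a = m1 g a"
    "\<And>c. c \<in> arr C \<Longrightarrow> m2 f c = m2 g c"
  shows "f = g"
  using assms xend_ext[OF assms(1)] xend_ext[OF assms(2)]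
  by (auto intro!: xmor.equality extensionalityI)

lemma End_simps:
  "carrier (End_monoid X) = xend X"
  "x \<in> obj G \<Longrightarrow> m0 (f \<otimes>\<^bsub>End_monoid X\<^esub> g) x = m0 f (m0 g x)"
  "a \<in> arr G \<Longrightarrow> m1 (f \<otimes>\<^bsub>End_monoid X\<^esub> g) a = m1 f (m1 g a)"
  "c \<in> arr C \<Longrightarrow> m2 (f \<otimes>\<^bsub>End_monoid X\<^esub> g) c = m2 f (m2 g c)"
  "x \<in> obj G \<Longrightarrow> m0 \<one>\<^bsub>End_monoid X\<^esub> x = x"
  "a \<in> arr G \<Longrightarrow> m1 \<one>\<^bsub>End_monoid X\<^esub> a = a"
  "c \<in> arr C \<Longrightarrow> m2 \<one>\<^bsub>End_monoid X\<^esub> c = c"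
  by (simp_all add: End_monoid_def compose_def G_def C_def)

lemma End_mult_closed:
  assumes "f \<in> xend X" "g \<in> xend X"
  shows "f \<otimes>\<^bsub>End_monoid X\<^esub> g \<in> xend X"
  by (rule xendI)
     (use assms in \<open>simp_all add: End_simps xmod_simps xend_rules\<close>,
      simp_all add: End_monoid_def G_def C_def)

lemma End_one_closed: "\<one>\<^bsub>End_monoid X\<^esub> \<in> xend X"
  by (rule xendI)
     (simp_all add: End_simps xmod_simps,
      simp_all add: End_monoid_def G_def C_def)

lemma monoid_End: "monoid (End_monoid X)"
  by unfold_locales
     (auto simp: End_simps End_mult_closed End_one_closed xend_rules intro!: xmor_eqI)

sublocale End: monoid "End_monoid X"
  by (rule monoid_End)

lemma Aut_simps:
  "mult (Aut X) = mult (End_monoid X)" "one (Aut X) = one (End_monoid X)"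
  by (simp_all add: Aut_def units_of_def)

lemma Aut_xend: "f \<in> carrier (Aut X) \<Longrightarrow> f \<in> xend X"
  by (simp add: Aut_def units_of_carrier Units_def End_simps)

sublocale Aut: group "Aut X"
  unfolding Aut_def by (rule End.units_group)

section \<open>Homotopies and their sources\<close>

lemma homotopyD:
  assumes "homotopy X s"
  shows "hbase s \<in> xend X"
    "h0 s \<in> extensional (obj G)" "h1 s \<in> extensional (arr G)"
    "x \<in> obj G \<Longrightarrow> h0 s x \<in> arr G"
    "x \<in> obj G \<Longrightarrow> tgt G (h0 s x) = m0 (hbase s) x"
    "a \<in> arr G \<Longrightarrow> h1 s a \<in> arr C"
    "a \<in> arr G \<Longrightarrow> tgt C (h1 s a) = m0 (hbase s) (tgt G a)"
    "\<lbrakk>a \<in> arr G; b \<in> arr G; tgt G a = src G b\<rbrakk>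
      \<Longrightarrow> h1 s (a \<boxplus>\<^bsub>G\<^esub> b) = h1 s a \<star> m1 (hbase s) b \<boxplus>\<^bsub>C\<^esub> h1 s b"
proof -
  show 1: "hbase s \<in> xend X" using assms by (simp add: homotopy_def Let_def)
  show "h0 s \<in> extensional (obj G)" "h1 s \<in> extensional (arr G)"
    "x \<in> obj G \<Longrightarrow> h0 s x \<in> arr G"
    "x \<in> obj G \<Longrightarrow> tgt G (h0 s x) = m0 (hbase s) x"
    "a \<in> arr G \<Longrightarrow> h1 s a \<in> arr C"
    "a \<in> arr G \<Longrightarrow> tgt C (h1 s a) = m0 (hbase s) (tgt G a)"
    "\<lbrakk>a \<in> arr G; b \<in> arr G; tgt G a = src G b\<rbrakk>
      \<Longrightarrow> h1 s (a \<boxplus>\<^bsub>G\<^esub> b) = h1 s a \<star> m1 (hbase s) b \<boxplus>\<^bsub>C\<^esub> h1 s b"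
    using assms xend_rules(4)[OF 1]
    by (auto simp: homotopy_def Let_def PiE_def simp flip: G_def C_def)
qed

lemma homotopyI:
  assumes "hbase s \<in> xend X"
    "h0 s \<in> extensional (obj G)" "h1 s \<in> extensional (arr G)"
    "\<And>x. x \<in> obj G \<Longrightarrow> h0 s x \<in> arr G"
    "\<And>x. x \<in> obj G \<Longrightarrow> tgt G (h0 s x) = m0 (hbase s) x"
    "\<And>a. a \<in> arr G \<Longrightarrow> h1 s a \<in> arr C"
    "\<And>a. a \<in> arr G \<Longrightarrow> tgt C (h1 s a) = m0 (hbase s) (tgt G a)"
    "\<And>a b. \<lbrakk>a \<in> arr G; b \<in> arr G; tgt G a = src G b\<rbrakk>
      \<Longrightarrow> h1 s (a \<boxplus>\<^bsub>G\<^esub> b) = h1 s a \<star> m1 (hbase s) b \<boxplus>\<^bsub>C\<^esub> h1 s b"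
  shows "homotopy X s"
  using assms by (auto simp: homotopy_def Let_def PiE_def xend_rules simp flip: G_def C_def)

lemma htpy_eqI:
  assumes "homotopy X s" "homotopy X t" "hbase s = hbase t"
    "\<And>x. x \<in> obj G \<Longrightarrow> h0 s x = h0 t x"
    "\<And>a. a \<in> arr G \<Longrightarrow> h1 s a = h1 t a"
  shows "s = t"
  using assms homotopyD(2,3)[OF assms(1)] homotopyD(2,3)[OF assms(2)]
  by (auto intro!: htpy.equality extensionalityI)

text \<open>In the derivation rule for \<open>O_x + O_x\<close> the exponent is an identity, so the
  value at \<open>O_x\<close> is an idempotent loop.\<close>

lemma homotopy_idt:
  assumes s: "homotopy X s" and x: "x \<in> obj G"
  shows "h1 s (idt G x) = idt C (m0 (hbase s) x)"
  using fib.idempotent_imp_idt[of "h1 s (idt G x)"] homotopyD(8)[OF s, of "idt G x" "idt G x"] x s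
  by (simp add: xmod_simps homotopyD xend_rules tot_intrans)

text \<open>The derivation rule for a + (-a), where the left side is an identity, makes
  \<open>s_1(a)^(-f_1 a)\<close> a left inverse of \<open>s_1(-a)\<close>.\<close>

lemma homotopy_neg:
  assumes s: "homotopy X s" and a: "a \<in> arr G"
  shows "h1 s (\<boxminus>\<^bsub>G\<^esub> a) = \<boxminus>\<^bsub>C\<^esub> (h1 s a \<star> \<boxminus>\<^bsub>G\<^esub> m1 (hbase s) a)"
proof -
  have "h1 s a \<star> \<boxminus>\<^bsub>G\<^esub> m1 (hbase s) a = \<boxminus>\<^bsub>C\<^esub> h1 s (\<boxminus>\<^bsub>G\<^esub> a)"
    using homotopyD(8)[OF s, of a "\<boxminus>\<^bsub>G\<^esub> a"] a s
    by (intro fib.neg_eqI')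
       (simp_all add: xmod_simps homotopyD homotopy_idt xend_rules tot_intrans)
  then show ?thesis
    using a s by (simp add: xmod_simps homotopyD)
qed

lemmas homotopy_rules = homotopyD(1,4-8) homotopy_idt homotopy_neg

lemma hsource_simps:
  "x \<in> obj G \<Longrightarrow> m0 (hsource X s) x = src G (h0 s x)"
  "a \<in> arr G \<Longrightarrow> m1 (hsource X s) a =
     h0 s (src G a) \<boxplus>\<^bsub>G\<^esub> m1 (hbase s) a \<boxplus>\<^bsub>G\<^esub> bd X (h1 s a) \<boxplus>\<^bsub>G\<^esub> \<boxminus>\<^bsub>G\<^esub> h0 s (tgt G a)"
  "c \<in> arr C \<Longrightarrow> m2 (hsource X s) c =
     (m2 (hbase s) c \<boxplus>\<^bsub>C\<^esub> h1 s (bd X c)) \<star> (\<boxminus>\<^bsub>G\<^esub> h0 s (tgt C c))"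
  by (simp_all add: hsource_def Let_def G_def C_def)

lemma hsource_ext:
  "m0 (hsource X s) \<in> extensional (obj G)" "m1 (hsource X s) \<in> extensional (arr G)"
  "m2 (hsource X s) \<in> extensional (arr C)"
  by (simp_all add: hsource_def Let_def G_def C_def)

text \<open>In the image of a + b the inner terms \<open>s_0\<close> cancel, and moving
  \<open>\<delta> s_1(a)\<close> past \<open>f_1(b)\<close> turns it into
  \<open>\<delta>(s_1(a)^(f_1 b))\<close>, as the derivation rule requires. On C the exponent
  \<open>f_1(\<delta> d) = \<delta> f_2(d)\<close> acts by conjugation, so the same rearrangement
  works.\<close>

lemma hsource_xend:
  assumes "homotopy X s"
  shows "hsource X s \<in> xend X"
  by (rule xendI) (use assms in \<open>simp_all add: hsource_ext hsource_simps xmod_simps homotopy_rules xend_rules\<close>)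

lemma hsource_eqI:
  assumes "homotopy X s" "f \<in> xend X"
    "\<And>x. x \<in> obj G \<Longrightarrow> src G (h0 s x) = m0 f x"
    "\<And>a. a \<in> arr G \<Longrightarrow> h0 s (src G a) \<boxplus>\<^bsub>G\<^esub> m1 (hbase s) a \<boxplus>\<^bsub>G\<^esub> bd X (h1 s a) \<boxplus>\<^bsub>G\<^esub>
       \<boxminus>\<^bsub>G\<^esub> h0 s (tgt G a) = m1 f a"
    "\<And>c. c \<in> arr C \<Longrightarrow> (m2 (hbase s) c \<boxplus>\<^bsub>C\<^esub> h1 s (bd X c)) \<star> (\<boxminus>\<^bsub>G\<^esub> h0 s (tgt C c)) = m2 f c"
  shows "hsource X s = f"
  using assms by (intro xmor_eqI hsource_xend) (simp_all add: hsource_simps)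

lemmas htpy_simps = xmod_simps homotopy_rules xend_rules hsource_simps hsource_xend

end

section \<open>The crossed module $AUT(C)$\<close>

context crossed_module
begin

section \<open>The groupoid of homotopies between automorphisms\<close>

lemma AUT_1_simps:
  "obj (AUT_1 X) = carrier (Aut X)"
  "s \<in> arr (AUT_1 X) \<longleftrightarrow>
     homotopy X s \<and> hbase s \<in> carrier (Aut X) \<and> hsource X s \<in> carrier (Aut X)"
  "src (AUT_1 X) = hsource X"
  "tgt (AUT_1 X) = hbase"
  "hbase (s \<boxplus>\<^bsub>AUT_1 X\<^esub> t) = hbase t"
  "x \<in> obj G \<Longrightarrow> h0 (s \<boxplus>\<^bsub>AUT_1 X\<^esub> t) x = h0 s x \<boxplus>\<^bsub>G\<^esub> h0 t x"
  "a \<in> arr G \<Longrightarrow> h1 (s \<boxplus>\<^bsub>AUT_1 X\<^esub> t) a = h1 t a \<boxplus>\<^bsub>C\<^esub> h1 s a \<star> h0 t (tgt G a)"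
  "hbase (idt (AUT_1 X) f) = f"
  "x \<in> obj G \<Longrightarrow> h0 (idt (AUT_1 X) f) x = idt G (m0 f x)"
  "a \<in> arr G \<Longrightarrow> h1 (idt (AUT_1 X) f) a = idt C (tgt G (m1 f a))"
  by (simp_all add: AUT_1_def Let_def G_def C_def)

lemma AUT_1_ext:
  "h0 (s \<boxplus>\<^bsub>AUT_1 X\<^esub> t) \<in> extensional (obj G)" "h1 (s \<boxplus>\<^bsub>AUT_1 X\<^esub> t) \<in> extensional (arr G)"
  "h0 (idt (AUT_1 X) f) \<in> extensional (obj G)" "h1 (idt (AUT_1 X) f) \<in> extensional (arr G)"
  by (simp_all add: AUT_1_def Let_def G_def C_def)

text \<open>With f the source of t and g its base, \<open>f(b) + t_0(\<beta> b) = t_0(\<alpha> b) +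
  g(b) + \<delta> t_1(b)\<close>. The exponent \<open>\<delta> t_1(b)\<close> conjugates by
  \<open>t_1(b)\<close>, which brings the summands into the order of the derivation rule.\<close>

lemma homotopy_AUT_1_add:
  assumes "homotopy X s" "homotopy X t" "hbase s = hsource X t"
  shows "homotopy X (s \<boxplus>\<^bsub>AUT_1 X\<^esub> t)"
  by (rule homotopyI) (use assms in \<open>simp_all add: AUT_1_simps AUT_1_ext htpy_simps\<close>)

text \<open>The formula for the source of s + t contains
  \<open>t_0 + g(a) + \<delta> t_1(a) - t_0\<close>, with g the base of t. This is the source of t,
  hence the base of s, and what remains is the formula for the source of s.\<close>

lemma hsource_AUT_1_add:
  assumes "homotopy X s" "homotopy X t" "hbase s = hsource X t"
  shows "hsource X (s \<boxplus>\<^bsub>AUT_1 X\<^esub> t) = hsource X s"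
  by (rule hsource_eqI)
     (use assms in \<open>simp_all add: homotopy_AUT_1_add AUT_1_simps htpy_simps\<close>)

lemma homotopy_AUT_1_idt:
  assumes "f \<in> xend X"
  shows "homotopy X (idt (AUT_1 X) f)"
  by (rule homotopyI) (use assms in \<open>simp_all add: AUT_1_simps AUT_1_ext htpy_simps\<close>)

lemma hsource_AUT_1_idt:
  assumes "f \<in> xend X"
  shows "hsource X (idt (AUT_1 X) f) = f"
  by (rule hsource_eqI)
     (use assms in \<open>simp_all add: homotopy_AUT_1_idt AUT_1_simps htpy_simps\<close>)

text \<open>The components solve \<open>s_0 + u_0 = 0\<close> and
  \<open>u_1(a) + s_1(a)^(u_0(\<beta> a)) = 0\<close>, the conditions for s + u to be an identity;
  the base must then be the source of s.\<close>

definition htpy_neg where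
  "htpy_neg s = \<lparr>h0 = \<lambda>x\<in>obj G. \<boxminus>\<^bsub>G\<^esub> h0 s x,
     h1 = \<lambda>a\<in>arr G. \<boxminus>\<^bsub>C\<^esub> (h1 s a \<star> \<boxminus>\<^bsub>G\<^esub> h0 s (tgt G a)), hbase = hsource X s\<rparr>"

lemma htpy_neg_simps:
  "hbase (htpy_neg s) = hsource X s"
  "x \<in> obj G \<Longrightarrow> h0 (htpy_neg s) x = \<boxminus>\<^bsub>G\<^esub> h0 s x"
  "a \<in> arr G \<Longrightarrow> h1 (htpy_neg s) a = \<boxminus>\<^bsub>C\<^esub> (h1 s a \<star> \<boxminus>\<^bsub>G\<^esub> h0 s (tgt G a))"
  "h0 (htpy_neg s) \<in> extensional (obj G)" "h1 (htpy_neg s) \<in> extensional (arr G)"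
  by (simp_all add: htpy_neg_def)

lemma homotopy_htpy_neg:
  assumes "homotopy X s"
  shows "homotopy X (htpy_neg s)"
  by (rule homotopyI) (use assms in \<open>simp_all add: htpy_neg_simps htpy_simps\<close>)

lemma hsource_htpy_neg:
  assumes "homotopy X s"
  shows "hsource X (htpy_neg s) = hbase s"
  by (rule hsource_eqI)
     (use assms in \<open>simp_all add: homotopy_htpy_neg htpy_neg_simps htpy_simps\<close>)

lemma is_neg_htpy_neg:
  assumes s: "s \<in> arr (AUT_1 X)"
  shows "is_neg (AUT_1 X) s (htpy_neg s)"
proof -
  have "s \<boxplus>\<^bsub>AUT_1 X\<^esub> htpy_neg s = idt (AUT_1 X) (hsource X s)"
    by (rule htpy_eqI)
       (use s in \<open>simp_all add: AUT_1_simps homotopy_AUT_1_add homotopy_AUT_1_idt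
          homotopy_htpy_neg hsource_htpy_neg htpy_neg_simps htpy_simps Aut_xend\<close>)
  moreover have "htpy_neg s \<boxplus>\<^bsub>AUT_1 X\<^esub> s = idt (AUT_1 X) (hbase s)"
    by (rule htpy_eqI)
       (use s in \<open>simp_all add: AUT_1_simps homotopy_AUT_1_add homotopy_AUT_1_idt
          homotopy_htpy_neg hsource_htpy_neg htpy_neg_simps htpy_simps Aut_xend\<close>)
  ultimately show ?thesis
    using s by (simp add: is_neg_def AUT_1_simps homotopy_htpy_neg hsource_htpy_neg htpy_neg_simps)
qed

lemma groupoid_AUT_1: "groupoid (AUT_1 X)"
proof
  fix s t u
  assume "s \<in> arr (AUT_1 X)" "t \<in> arr (AUT_1 X)" "u \<in> arr (AUT_1 X)"
    "tgt (AUT_1 X) s = src (AUT_1 X) t" "tgt (AUT_1 X) t = src (AUT_1 X) u"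
  then show "s \<boxplus>\<^bsub>AUT_1 X\<^esub> t \<boxplus>\<^bsub>AUT_1 X\<^esub> u = s \<boxplus>\<^bsub>AUT_1 X\<^esub> (t \<boxplus>\<^bsub>AUT_1 X\<^esub> u)"
    by (intro htpy_eqI)
       (simp_all add: AUT_1_simps homotopy_AUT_1_add hsource_AUT_1_add htpy_simps)
next
  fix s
  assume "s \<in> arr (AUT_1 X)"
  then show "idt (AUT_1 X) (src (AUT_1 X) s) \<boxplus>\<^bsub>AUT_1 X\<^esub> s = s"
    and "s \<boxplus>\<^bsub>AUT_1 X\<^esub> idt (AUT_1 X) (tgt (AUT_1 X) s) = s"
    by (auto intro!: htpy_eqI simp: AUT_1_simps homotopy_AUT_1_add homotopy_AUT_1_idt
          hsource_AUT_1_idt htpy_simps)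
qed (use is_neg_htpy_neg in \<open>auto simp: AUT_1_simps homotopy_AUT_1_add hsource_AUT_1_add
       homotopy_AUT_1_idt hsource_AUT_1_idt Aut_xend\<close>)

sublocale AUT_1: groupoid "AUT_1 X"
  by (rule groupoid_AUT_1)

lemma neg_AUT_1: "s \<in> arr (AUT_1 X) \<Longrightarrow> \<boxminus>\<^bsub>AUT_1 X\<^esub> s = htpy_neg s"
  by (simp add: AUT_1.neg_eqI is_neg_htpy_neg)

section \<open>The groupoid of sections over automorphisms\<close>

lemma AUT_2_simps:
  "obj (AUT_2 X) = carrier (Aut X)"
  "(s, f) \<in> arr (AUT_2 X) \<longleftrightarrow> f \<in> carrier (Aut X) \<and> s \<in> extensional (obj G) \<and>
     (\<forall>x\<in>obj G. s x \<in> arr C \<and> tgt C (s x) = m0 f x)"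
  "src (AUT_2 X) = snd"
  "tgt (AUT_2 X) = snd"
  "(s, f) \<boxplus>\<^bsub>AUT_2 X\<^esub> (t, f') = (\<lambda>x\<in>obj G. s x \<boxplus>\<^bsub>C\<^esub> t x, f)"
  "idt (AUT_2 X) f = (\<lambda>x\<in>obj G. idt C (m0 f x), f)"
  by (auto simp: AUT_2_def Let_def PiE_def simp flip: G_def C_def)

lemma is_neg_AUT_2:
  assumes "(s, f) \<in> arr (AUT_2 X)"
  shows "is_neg (AUT_2 X) (s, f) (\<lambda>x\<in>obj G. \<boxminus>\<^bsub>C\<^esub> s x, f)"
  using assms
  by (auto simp: is_neg_def AUT_2_simps xmod_simps cong: restrict_cong)

lemma groupoid_AUT_2: "groupoid (AUT_2 X)"
proof
  fix c d e :: "('x \<Rightarrow> 'c) \<times> ('x, 'g, 'c) xmor"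
  assume "c \<in> arr (AUT_2 X)" "d \<in> arr (AUT_2 X)" "e \<in> arr (AUT_2 X)"
    "tgt (AUT_2 X) c = src (AUT_2 X) d" "tgt (AUT_2 X) d = src (AUT_2 X) e"
  then show "c \<boxplus>\<^bsub>AUT_2 X\<^esub> d \<boxplus>\<^bsub>AUT_2 X\<^esub> e = c \<boxplus>\<^bsub>AUT_2 X\<^esub> (d \<boxplus>\<^bsub>AUT_2 X\<^esub> e)"
    by (cases c; cases d; cases e) (simp add: AUT_2_simps xmod_simps cong: restrict_cong)
qed (auto simp: AUT_2_simps xmod_simps xend_rules Aut_xend
       intro: is_neg_AUT_2 intro!: extensionalityI[of _ "obj G"])

sublocale AUT_2: groupoid "AUT_2 X"
  by (rule groupoid_AUT_2)

lemma neg_AUT_2: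
  "(s, f) \<in> arr (AUT_2 X) \<Longrightarrow> \<boxminus>\<^bsub>AUT_2 X\<^esub> (s, f) = (\<lambda>x\<in>obj G. \<boxminus>\<^bsub>C\<^esub> s x, f)"
  by (simp add: AUT_2.neg_eqI is_neg_AUT_2)

section \<open>Boundary and action\<close>

lemma AUT_xmod_simps:
  "base (AUT_xmod X) = AUT_1 X" "fib (AUT_xmod X) = AUT_2 X"
  "hbase (bd (AUT_xmod X) (s, f)) = f"
  "x \<in> obj G \<Longrightarrow> h0 (bd (AUT_xmod X) (s, f)) x = bd X (s x)"
  "a \<in> arr G \<Longrightarrow> h1 (bd (AUT_xmod X) (s, f)) a = \<boxminus>\<^bsub>C\<^esub> (s (src G a) \<star> m1 f a) \<boxplus>\<^bsub>C\<^esub> s (tgt G a)"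
  "h0 (bd (AUT_xmod X) (s, f)) \<in> extensional (obj G)"
  "h1 (bd (AUT_xmod X) (s, f)) \<in> extensional (arr G)"
  "(s, f) \<star>\<^bsub>AUT_xmod X\<^esub> t = (\<lambda>x\<in>obj G. s x \<star> h0 t x, hbase t)"
  by (simp_all add: AUT_xmod_def Let_def G_def C_def)

lemma homotopy_bd:
  assumes "(s, f) \<in> arr (AUT_2 X)"
  shows "homotopy X (bd (AUT_xmod X) (s, f))"
  by (rule homotopyI)
     (use assms in \<open>simp_all add: AUT_2_simps AUT_xmod_simps htpy_simps Aut_xend\<close>)

text \<open>The boundary is a loop. On G the terms \<open>\<delta> s\<close> cancel. On C the
  Peiffer rule turns \<open>f_2(c) + s_1(\<delta> c)\<close> into the conjugate -s +
  \<open>f_2(c)\<close> + s, and acting by \<open>-\<delta> s\<close> undoes the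
  conjugation.\<close>

lemma hsource_bd:
  assumes "(s, f) \<in> arr (AUT_2 X)"
  shows "hsource X (bd (AUT_xmod X) (s, f)) = f"
  by (rule hsource_eqI)
     (use assms homotopy_bd[OF assms] in
       \<open>simp_all add: AUT_2_simps AUT_xmod_simps htpy_simps Aut_xend\<close>)

lemma crossed_module_AUT_xmod: "crossed_module (AUT_xmod X)"
proof (rule crossed_module.intro)
  show "groupoid (base (AUT_xmod X))" "groupoid (fib (AUT_xmod X))"
    by (simp_all add: AUT_xmod_simps groupoid_AUT_1 groupoid_AUT_2)
next
  fix c d
  assume "c \<in> arr (fib (AUT_xmod X))" "d \<in> arr (fib (AUT_xmod X))"
    "tgt (fib (AUT_xmod X)) c = src (fib (AUT_xmod X)) d"
  then obtain s f t where c: "c = (s, f)" "d = (t, f)" "(s, f) \<in> arr (AUT_2 X)"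
    "(t, f) \<in> arr (AUT_2 X)"
    by (cases c; cases d) (auto simp: AUT_xmod_simps AUT_2_simps)
  have "(\<lambda>x\<in>obj G. s x \<boxplus>\<^bsub>C\<^esub> t x, f) \<in> arr (AUT_2 X)"
    using AUT_2.add_closed[of "(s, f)" "(t, f)"] c by (simp add: AUT_2_simps)
  then show "bd (AUT_xmod X) (c \<boxplus>\<^bsub>fib (AUT_xmod X)\<^esub> d) =
      bd (AUT_xmod X) c \<boxplus>\<^bsub>base (AUT_xmod X)\<^esub> bd (AUT_xmod X) d"
    unfolding c(1,2) AUT_xmod_simps AUT_2_simps(5)
    by (intro htpy_eqI homotopy_AUT_1_add homotopy_bd)
      (use c in \<open>simp_all add: hsource_bd AUT_1_simps AUT_xmod_simps AUT_2_simps htpy_simps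
         Aut_xend\<close>)
next
  fix c t
  assume "c \<in> arr (fib (AUT_xmod X))" "t \<in> arr (base (AUT_xmod X))"
    "tgt (fib (AUT_xmod X)) c = src (base (AUT_xmod X)) t"
  then obtain s where c: "c = (s, hsource X t)" "(s, hsource X t) \<in> arr (AUT_2 X)"
    and t: "t \<in> arr (AUT_1 X)"
    by (cases c) (auto simp: AUT_xmod_simps AUT_1_simps AUT_2_simps)
  have st: "c \<star>\<^bsub>AUT_xmod X\<^esub> t \<in> arr (AUT_2 X)"
    using c t by (auto simp: AUT_xmod_simps AUT_1_simps AUT_2_simps htpy_simps)
  have bc: "bd (AUT_xmod X) c \<in> arr (AUT_1 X)" "hsource X (bd (AUT_xmod X) c) = hsource X t"
    "hbase (bd (AUT_xmod X) c) = hsource X t"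
    using c t by (auto simp: AUT_1_simps AUT_2_simps AUT_xmod_simps homotopy_bd hsource_bd)
  \<comment> \<open>Composable because -t ends at the source of t, where the boundary of c is a loop
    and t starts.\<close>
  then have "homotopy X (\<boxminus>\<^bsub>AUT_1 X\<^esub> t \<boxplus>\<^bsub>AUT_1 X\<^esub> bd (AUT_xmod X) c \<boxplus>\<^bsub>AUT_1 X\<^esub> t)"
    using c t by (simp add: neg_AUT_1 AUT_1_simps homotopy_AUT_1_add homotopy_htpy_neg
       htpy_neg_simps)
  then have "bd (AUT_xmod X) (c \<star>\<^bsub>AUT_xmod X\<^esub> t) =
      \<boxminus>\<^bsub>AUT_1 X\<^esub> t \<boxplus>\<^bsub>AUT_1 X\<^esub> bd (AUT_xmod X) c \<boxplus>\<^bsub>AUT_1 X\<^esub> t"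
    by (intro htpy_eqI)
      (use c t st in \<open>simp_all add: homotopy_bd neg_AUT_1 htpy_neg_simps AUT_1_simps AUT_xmod_simps
         AUT_2_simps htpy_simps Aut_xend\<close>)
  then show "bd (AUT_xmod X) (c \<star>\<^bsub>AUT_xmod X\<^esub> t) =
      \<boxminus>\<^bsub>base (AUT_xmod X)\<^esub> t \<boxplus>\<^bsub>base (AUT_xmod X)\<^esub> bd (AUT_xmod X) c
        \<boxplus>\<^bsub>base (AUT_xmod X)\<^esub> t"
    by (simp add: AUT_xmod_simps)
next
  fix c d
  assume "c \<in> arr (fib (AUT_xmod X))" "d \<in> arr (fib (AUT_xmod X))"
    "tgt (fib (AUT_xmod X)) c = tgt (fib (AUT_xmod X)) d"
  then obtain s f t where c: "c = (s, f)" "d = (t, f)" "(s, f) \<in> arr (AUT_2 X)"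
    "(t, f) \<in> arr (AUT_2 X)"
    by (cases c; cases d) (auto simp: AUT_xmod_simps AUT_2_simps)
  then show "c \<star>\<^bsub>AUT_xmod X\<^esub> bd (AUT_xmod X) d = \<boxminus>\<^bsub>fib (AUT_xmod X)\<^esub> d
      \<boxplus>\<^bsub>fib (AUT_xmod X)\<^esub> c \<boxplus>\<^bsub>fib (AUT_xmod X)\<^esub> d"
    by (simp add: AUT_xmod_simps neg_AUT_2)
      (auto simp: AUT_xmod_simps AUT_2_simps xmod_simps intro!: extensionalityI[of _ "obj G"])
qed (auto simp: AUT_xmod_simps AUT_1_simps AUT_2_simps homotopy_bd hsource_bd htpy_simps Aut_xend
   intro!: extensionalityI[of _ "obj G"])

end

section \<open>The braiding of $AUT(C)$\<close>

context crossed_module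
begin

section \<open>Translations by automorphisms, and the braiding\<close>

lemma AUT_sel:
  "grp (AUT X) = Aut X" "xm (AUT X) = AUT_xmod X"
  by (simp_all add: AUT_def Let_def)

lemma lract1_simps:
  "hbase (lact1 (AUT X) h s) = h \<otimes>\<^bsub>End_monoid X\<^esub> hbase s"
  "x \<in> obj G \<Longrightarrow> h0 (lact1 (AUT X) h s) x = m1 h (h0 s x)"
  "a \<in> arr G \<Longrightarrow> h1 (lact1 (AUT X) h s) a = m2 h (h1 s a)"
  "hbase (ract1 (AUT X) s h) = hbase s \<otimes>\<^bsub>End_monoid X\<^esub> h"
  "x \<in> obj G \<Longrightarrow> h0 (ract1 (AUT X) s h) x = h0 s (m0 h x)"
  "a \<in> arr G \<Longrightarrow> h1 (ract1 (AUT X) s h) a = h1 s (m1 h a)"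
  "h0 (lact1 (AUT X) h s) \<in> extensional (obj G)" "h1 (lact1 (AUT X) h s) \<in> extensional (arr G)"
  "h0 (ract1 (AUT X) s h) \<in> extensional (obj G)" "h1 (ract1 (AUT X) s h) \<in> extensional (arr G)"
  by (simp_all add: AUT_def Let_def Aut_simps compose_def G_def C_def)

lemma lract2_simps:
  "lact2 (AUT X) h (s, f) = (\<lambda>x\<in>obj G. m2 h (s x), h \<otimes>\<^bsub>End_monoid X\<^esub> f)"
  "ract2 (AUT X) (s, f) h = (\<lambda>x\<in>obj G. s (m0 h x), f \<otimes>\<^bsub>End_monoid X\<^esub> h)"
  by (simp_all add: AUT_def Let_def Aut_simps compose_def G_def)

lemma brd_simps:
  "brd (AUT X) s t = (\<lambda>x\<in>obj G. h1 s (h0 t x), hbase s \<otimes>\<^bsub>End_monoid X\<^esub> hbase t)"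
  by (simp add: AUT_def Let_def Aut_simps compose_def G_def)

lemma homotopy_lact1:
  assumes "homotopy X s" "h \<in> xend X"
  shows "homotopy X (lact1 (AUT X) h s)"
  by (rule homotopyI)
     (use assms in \<open>simp_all add: lract1_simps htpy_simps End_simps End_mult_closed\<close>)

lemma homotopy_ract1:
  assumes "homotopy X s" "h \<in> xend X"
  shows "homotopy X (ract1 (AUT X) s h)"
  by (rule homotopyI)
     (use assms in \<open>simp_all add: lract1_simps htpy_simps End_simps End_mult_closed\<close>)

text \<open>An endomorphism respects sums, \<delta> and the action, so it passes through the formula
  for the source; for right translates one substitutes instead, using that h commutes with \<alpha>,
  \<beta> and \<delta>.\<close>

lemma hsource_lact1:
  assumes "homotopy X s" "h \<in> xend X"
  shows "hsource X (lact1 (AUT X) h s) = h \<otimes>\<^bsub>End_monoid X\<^esub> hsource X s"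
  by (rule hsource_eqI)
     (use assms in \<open>simp_all add: homotopy_lact1 lract1_simps htpy_simps End_simps End_mult_closed\<close>)

lemma hsource_ract1:
  assumes "homotopy X s" "h \<in> xend X"
  shows "hsource X (ract1 (AUT X) s h) = hsource X s \<otimes>\<^bsub>End_monoid X\<^esub> h"
  by (rule hsource_eqI)
     (use assms in \<open>simp_all add: homotopy_ract1 lract1_simps htpy_simps End_simps End_mult_closed\<close>)

lemma Aut_closed: 
  "\<lbrakk>f \<in> carrier (Aut X); g \<in> carrier (Aut X)\<rbrakk> \<Longrightarrow> f \<otimes>\<^bsub>End_monoid X\<^esub> g \<in> carrier (Aut X)"
  "\<one>\<^bsub>End_monoid X\<^esub> \<in> carrier (Aut X)"
  "f \<in> carrier (Aut X) \<Longrightarrow> f \<otimes>\<^bsub>End_monoid X\<^esub> \<one>\<^bsub>End_monoid X\<^esub> = f"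
  "f \<in> carrier (Aut X) \<Longrightarrow> \<one>\<^bsub>End_monoid X\<^esub> \<otimes>\<^bsub>End_monoid X\<^esub> f = f"
  "\<lbrakk>f \<in> carrier (Aut X); g \<in> carrier (Aut X); h \<in> carrier (Aut X)\<rbrakk>
     \<Longrightarrow> f \<otimes>\<^bsub>End_monoid X\<^esub> g \<otimes>\<^bsub>End_monoid X\<^esub> h = f \<otimes>\<^bsub>End_monoid X\<^esub> (g \<otimes>\<^bsub>End_monoid X\<^esub> h)"
  using Aut.m_closed Aut.one_closed Aut.r_one Aut.l_one Aut.m_assoc by (simp_all add: Aut_simps)

lemmas AUT_simps = AUT_sel lract1_simps lract2_simps brd_simps AUT_xmod_simps AUT_1_simps
  AUT_2_simps Aut_simps Aut_closed Aut_xend End_simps End_mult_closed End_one_closed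

lemmas AUT_closed = homotopy_lact1 homotopy_ract1 hsource_lact1 hsource_ract1
  homotopy_AUT_1_add hsource_AUT_1_add homotopy_AUT_1_idt hsource_AUT_1_idt
  homotopy_bd hsource_bd

lemma biaction_AUT_1: "biaction (Aut X) (AUT_1 X) (lact1 (AUT X)) (ract1 (AUT X))"
  by (auto simp: biaction_def AUT_simps AUT_closed htpy_simps intro!: htpy_eqI)

lemma biaction_AUT_2: "biaction (Aut X) (AUT_2 X) (lact2 (AUT X)) (ract2 (AUT X))"
  by (auto simp: biaction_def AUT_simps htpy_simps intro!: extensionalityI[of _ "obj G"])

lemma regular_AUT: "regular_xmod (AUT X)"
  unfolding regular_xmod_def Let_def AUT_sel AUT_xmod_simps(1,2)
proof (intro conjI ballI impI)
  show "group (Aut X)" by (rule Aut.is_group)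
next
  fix f c
  assume f: "f \<in> carrier (Aut X)" and "c \<in> arr (AUT_2 X)"
  then obtain s h where c: "c = (s, h)" "(s, h) \<in> arr (AUT_2 X)" by (cases c) auto
  have "(\<lambda>x\<in>obj G. m2 f (s x), f \<otimes>\<^bsub>End_monoid X\<^esub> h) \<in> arr (AUT_2 X)"
    "(\<lambda>x\<in>obj G. s (m0 f x), h \<otimes>\<^bsub>End_monoid X\<^esub> f) \<in> arr (AUT_2 X)"
    using c f by (auto simp: AUT_simps htpy_simps)
  note 1 = this[THEN homotopy_bd]
  show "bd (AUT_xmod X) (lact2 (AUT X) f c) = lact1 (AUT X) f (bd (AUT_xmod X) c)"
    unfolding c(1) lract2_simps
    by (rule htpy_eqI[OF 1(1)])
      (use c f homotopy_bd[OF c(2)] in \<open>auto simp: AUT_simps AUT_closed htpy_simps\<close>)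
  show "bd (AUT_xmod X) (ract2 (AUT X) c f) = ract1 (AUT X) (bd (AUT_xmod X) c) f"
    unfolding c(1) lract2_simps
    by (rule htpy_eqI[OF 1(2)])
      (use c f homotopy_bd[OF c(2)] in \<open>auto simp: AUT_simps AUT_closed htpy_simps\<close>)
qed (auto simp: crossed_module_AUT_xmod AUT_simps htpy_simps biaction_AUT_1 biaction_AUT_2
  intro!: extensionalityI[of _ "obj G"])

text \<open>The \<open>h1\<close>-components agree because \<open>s\<^sub>1\<close> is a derivation and, with \<open>f'\<close> and \<open>g\<close> the target and
  source of \<open>t\<close>, \<open>g(a) + t\<^sub>0(\<beta> a) = t\<^sub>0(\<alpha> a) + f'(a) + \<delta> t\<^sub>1(a)\<close>.\<close>

lemma bd_brd_AUT:
  assumes s: "s \<in> arr (AUT_1 X)" and t: "t \<in> arr (AUT_1 X)"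
  shows "bd (AUT_xmod X) (brd (AUT X) s t) =
    \<boxminus>\<^bsub>AUT_1 X\<^esub> lact1 (AUT X) (hbase s) t \<boxplus>\<^bsub>AUT_1 X\<^esub>
    \<boxminus>\<^bsub>AUT_1 X\<^esub> ract1 (AUT X) s (hsource X t) \<boxplus>\<^bsub>AUT_1 X\<^esub>
    lact1 (AUT X) (hsource X s) t \<boxplus>\<^bsub>AUT_1 X\<^esub> ract1 (AUT X) s (hbase t)"
proof -
  have b: "brd (AUT X) s t \<in> arr (AUT_2 X)"
    using s t by (auto simp: AUT_simps htpy_simps)
  have l: "lact1 (AUT X) (hbase s) t \<in> arr (AUT_1 X)" "ract1 (AUT X) s (hsource X t) \<in> arr (AUT_1 X)"
    using s t by (simp_all add: AUT_simps AUT_closed htpy_simps)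
  show ?thesis
    unfolding neg_AUT_1[OF l(1)] neg_AUT_1[OF l(2)]
  proof (rule htpy_eqI)
    show "homotopy X (bd (AUT_xmod X) (brd (AUT X) s t))"
      using b homotopy_bd by (simp add: brd_simps)
  qed (use s t b in \<open>simp_all add: AUT_simps AUT_closed htpy_neg_simps homotopy_htpy_neg
         hsource_htpy_neg htpy_simps\<close>)
qed

text \<open>The boundary of the braiding is \<open>bd_brd_AUT\<close>; the other axioms are
  pointwise. Expansion in the second argument is the derivation rule for \<open>s_1\<close>,
  expansion in the first is the definition of a sum of homotopies, {a, \<delta> c} is the formula
  for the source on C, and {\<delta> c, b} is the definition of \<delta>.\<close>

lemma braided_AUT: "braided_regular (AUT X)"
  unfolding braided_regular_def Let_def AUT_sel AUT_xmod_simps(1,2) 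
  by (auto simp: regular_AUT AUT_1_simps(3,4) bd_brd_AUT)
    (auto simp: AUT_simps htpy_simps neg_AUT_2 intro!: extensionalityI[of _ "obj G"])

end

section \<open>The associated 2-crossed module\<close>

context group
begin

lemma inv_mult_cancel:
  "\<lbrakk>x \<in> carrier G; y \<in> carrier G\<rbrakk> \<Longrightarrow> x \<otimes> (inv x \<otimes> y) = y"
  "\<lbrakk>x \<in> carrier G; y \<in> carrier G\<rbrakk> \<Longrightarrow> inv x \<otimes> (x \<otimes> y) = y"
  by (simp_all add: m_assoc[symmetric])

lemmas group_word_simps = m_assoc inv_mult_group inv_mult_cancel l_inv r_inv

end

text \<open>Captures what \<open>A_1\<close> and \<open>A_2\<close> share, so that the rules for
  translates are proved once and instantiated twice.\<close>

locale groupoid_biaction = groupoid A + P: group P for P A l r +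
  assumes obj_eq: "obj A = carrier P"
    and biaction: "biaction P A l r"
begin

lemma biact_closed:
  assumes "x \<in> carrier P" "a \<in> arr A"
  shows "l x a \<in> arr A" "src A (l x a) = x \<otimes>\<^bsub>P\<^esub> src A a" "tgt A (l x a) = x \<otimes>\<^bsub>P\<^esub> tgt A a"
    "r a x \<in> arr A" "src A (r a x) = src A a \<otimes>\<^bsub>P\<^esub> x" "tgt A (r a x) = tgt A a \<otimes>\<^bsub>P\<^esub> x"
  using biaction assms by (simp_all add: biaction_def)

lemma biact_assoc:
  assumes "a \<in> arr A" 
  shows "l \<one>\<^bsub>P\<^esub> a = a" "r a \<one>\<^bsub>P\<^esub> = a"
    "\<lbrakk>x \<in> carrier P; y \<in> carrier P\<rbrakk> \<Longrightarrow> l (x \<otimes>\<^bsub>P\<^esub> y) a = l x (l y a)"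
    "\<lbrakk>x \<in> carrier P; y \<in> carrier P\<rbrakk> \<Longrightarrow> r a (x \<otimes>\<^bsub>P\<^esub> y) = r (r a x) y"
    "\<lbrakk>x \<in> carrier P; y \<in> carrier P\<rbrakk> \<Longrightarrow> l x (r a y) = r (l x a) y"
  using biaction assms unfolding biaction_def by blast+

lemma biact_add:
  assumes "x \<in> carrier P" "a \<in> arr A" "b \<in> arr A" "tgt A a = src A b"
  shows "l x (a \<boxplus>\<^bsub>A\<^esub> b) = l x a \<boxplus>\<^bsub>A\<^esub> l x b" "r (a \<boxplus>\<^bsub>A\<^esub> b) x = r a x \<boxplus>\<^bsub>A\<^esub> r b x"
  using biaction assms unfolding biaction_def by blast+

lemma biact_inv:
  assumes "a \<in> arr A" "x \<in> carrier P"
  shows "l x (l (inv\<^bsub>P\<^esub> x) a) = a" "l (inv\<^bsub>P\<^esub> x) (l x a) = a"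
    "r (r a x) (inv\<^bsub>P\<^esub> x) = a" "r (r a (inv\<^bsub>P\<^esub> x)) x = a"
  using assms by (simp_all flip: biact_assoc(3,4) add: biact_assoc(1,2))

lemma src_carrier: "a \<in> arr A \<Longrightarrow> src A a \<in> carrier P"
  and tgt_carrier: "a \<in> arr A \<Longrightarrow> tgt A a \<in> carrier P"
  using src_closed tgt_closed obj_eq by simp_all

text \<open>Seen as morphisms of groupoids, translations preserve identities and inverses. The
  restrictions provide the extensionality that \<open>groupoid_hom\<close> asks for.\<close>

lemma groupoid_hom_lact: "x \<in> carrier P \<Longrightarrow>
    groupoid_hom A A (\<lambda>y\<in>obj A. x \<otimes>\<^bsub>P\<^esub> y) (\<lambda>a\<in>arr A. l x a)"
  and groupoid_hom_ract: "x \<in> carrier P \<Longrightarrow>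
    groupoid_hom A A (\<lambda>y\<in>obj A. y \<otimes>\<^bsub>P\<^esub> x) (\<lambda>a\<in>arr A. r a x)"
  by (auto simp: groupoid_hom_def biact_closed biact_add obj_eq src_carrier tgt_carrier add_closed)

lemma biact_idt:
  assumes "x \<in> carrier P" "y \<in> carrier P"
  shows "l x (idt A y) = idt A (x \<otimes>\<^bsub>P\<^esub> y)" "r (idt A y) x = idt A (y \<otimes>\<^bsub>P\<^esub> x)"
  using groupoid_hom_idt_neg(1)[OF groupoid_axioms groupoid_axioms groupoid_hom_lact, of x y]
    groupoid_hom_idt_neg(1)[OF groupoid_axioms groupoid_axioms groupoid_hom_ract, of x y] assms
  by (simp_all add: idt_closed obj_eq)

lemma biact_neg:
  assumes "x \<in> carrier P" "a \<in> arr A"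
  shows "l x (\<boxminus>\<^bsub>A\<^esub> a) = \<boxminus>\<^bsub>A\<^esub> (l x a)" "r (\<boxminus>\<^bsub>A\<^esub> a) x = \<boxminus>\<^bsub>A\<^esub> (r a x)"
  using groupoid_hom_idt_neg(2)[OF groupoid_axioms groupoid_axioms groupoid_hom_lact, of x a]
    groupoid_hom_idt_neg(2)[OF groupoid_axioms groupoid_axioms groupoid_hom_ract, of x a] assms
  by (simp_all add: neg_closed)

lemmas biact_simps = biact_closed biact_assoc biact_add biact_inv biact_idt biact_neg
  src_carrier tgt_carrier

end

section \<open>Rewriting in a braided regular crossed module\<close>

locale braided =
  fixes A :: "('p, 'a, 'b) bxmod"
  assumes braided: "braided_regular A"
begin

abbreviation P where "P \<equiv> grp A"
abbreviation A1 where "A1 \<equiv> base (xm A)"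
abbreviation A2 where "A2 \<equiv> fib (xm A)"
abbreviation l1 where "l1 \<equiv> lact1 A"
abbreviation r1 where "r1 \<equiv> ract1 A"
abbreviation l2 where "l2 \<equiv> lact2 A"
abbreviation r2 where "r2 \<equiv> ract2 A"

lemma regular: "regular_xmod A"
  using braided by (simp add: braided_regular_def)

sublocale P: group P
  using regular by (simp add: regular_xmod_def Let_def)

sublocale crossed_module "xm A" A1 A2
  using regular by (simp_all add: regular_xmod_def Let_def)

sublocale A1: groupoid_biaction P A1 l1 r1
  using regular
  by unfold_locales (simp_all add: regular_xmod_def Let_def)

sublocale A2: groupoid_biaction P A2 l2 r2
  using regular
  by unfold_locales (simp_all add: regular_xmod_def Let_def same_obj)

lemma bd_biact:
  "\<lbrakk>x \<in> carrier P; c \<in> arr A2\<rbrakk> \<Longrightarrow> bd (xm A) (l2 x c) = l1 x (bd (xm A) c)"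
  "\<lbrakk>x \<in> carrier P; c \<in> arr A2\<rbrakk> \<Longrightarrow> bd (xm A) (r2 c x) = r1 (bd (xm A) c) x"
  "\<lbrakk>z \<in> carrier P; c \<in> arr A2; a \<in> arr A1; tgt A2 c = src A1 a\<rbrakk> \<Longrightarrow>
     l2 z (c \<star>\<^bsub>xm A\<^esub> a) = l2 z c \<star>\<^bsub>xm A\<^esub> l1 z a"
  "\<lbrakk>z \<in> carrier P; c \<in> arr A2; a \<in> arr A1; tgt A2 c = src A1 a\<rbrakk> \<Longrightarrow>
     r2 (c \<star>\<^bsub>xm A\<^esub> a) z = r2 c z \<star>\<^bsub>xm A\<^esub> r1 a z"
  using regular by (simp_all add: regular_xmod_def Let_def)

text \<open>The translation axioms are oriented so that translates leave the bracket, except that a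
  right translate of the first argument becomes a left translate of the second and stays
  there.\<close>

lemma brd_rules:
  assumes "a \<in> arr A1" "b \<in> arr A1"
  shows "brd A a b \<in> arr A2" "tgt A2 (brd A a b) = tgt A1 a \<otimes>\<^bsub>P\<^esub> tgt A1 b"
    "\<lbrakk>b' \<in> arr A1; tgt A1 b = src A1 b'\<rbrakk> \<Longrightarrow>
       brd A a (b \<boxplus>\<^bsub>A1\<^esub> b') = brd A a b \<star>\<^bsub>xm A\<^esub> l1 (tgt A1 a) b' \<boxplus>\<^bsub>A2\<^esub> brd A a b'"
    "\<lbrakk>a' \<in> arr A1; tgt A1 a = src A1 a'\<rbrakk> \<Longrightarrow>
       brd A (a \<boxplus>\<^bsub>A1\<^esub> a') b = brd A a' b \<boxplus>\<^bsub>A2\<^esub> brd A a b \<star>\<^bsub>xm A\<^esub> r1 a' (tgt A1 b)"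
    "bd (xm A) (brd A a b) = \<boxminus>\<^bsub>A1\<^esub> l1 (tgt A1 a) b \<boxplus>\<^bsub>A1\<^esub> \<boxminus>\<^bsub>A1\<^esub> r1 a (src A1 b) \<boxplus>\<^bsub>A1\<^esub>
       l1 (src A1 a) b \<boxplus>\<^bsub>A1\<^esub> r1 a (tgt A1 b)"
    "x \<in> carrier P \<Longrightarrow> brd A (l1 x a) b = l2 x (brd A a b)"
    "x \<in> carrier P \<Longrightarrow> brd A a (r1 b x) = r2 (brd A a b) x"
    "x \<in> carrier P \<Longrightarrow> brd A (r1 a x) b = brd A a (l1 x b)"
  using braided assms by (auto simp: braided_regular_def Let_def)

lemma fib_biact_add:
  assumes "x \<in> carrier P" "c \<in> arr A2" "d \<in> arr A2" "tgt A2 c = tgt A2 d"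
  shows "l2 x (c \<boxplus>\<^bsub>A2\<^esub> d) = l2 x c \<boxplus>\<^bsub>A2\<^esub> l2 x d" "r2 (c \<boxplus>\<^bsub>A2\<^esub> d) x = r2 c x \<boxplus>\<^bsub>A2\<^esub> r2 d x"
  using assms by (simp_all add: A2.biact_add tot_intrans)

lemma brd_idt_bd:
  "b \<in> arr A1 \<Longrightarrow> brd A (idt A1 \<one>\<^bsub>P\<^esub>) b = idt A2 (tgt A1 b)"
  "\<lbrakk>a \<in> arr A1; c \<in> arr A2\<rbrakk> \<Longrightarrow> brd A a (bd (xm A) c) =
     \<boxminus>\<^bsub>A2\<^esub> l2 (tgt A1 a) c \<boxplus>\<^bsub>A2\<^esub> l2 (src A1 a) c \<star>\<^bsub>xm A\<^esub> r1 a (tgt A2 c)"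
  "\<lbrakk>c \<in> arr A2; b \<in> arr A1\<rbrakk> \<Longrightarrow> brd A (bd (xm A) c) b =
     \<boxminus>\<^bsub>A2\<^esub> (r2 c (src A1 b) \<star>\<^bsub>xm A\<^esub> l1 (tgt A2 c) b) \<boxplus>\<^bsub>A2\<^esub> r2 c (tgt A1 b)"
  using braided by (auto simp: braided_regular_def Let_def)

lemmas braided_simps = A1.biact_simps A2.biact_simps fib_biact_add bd_biact xmod_simps A1.obj_eq
  P.group_word_simps

text \<open>\<open>O_x\<close> is \<open>O_e.x\<close>, and \<open>{O_e.x, b} = {O_e, x.b}\<close>,
  to which the axiom for \<open>O_e\<close> applies.\<close>

lemma brd_idt_left:
  assumes "x \<in> carrier P" "b \<in> arr A1"
  shows "brd A (idt A1 x) b = idt A2 (x \<otimes>\<^bsub>P\<^esub> tgt A1 b)"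
  using brd_rules(8)[of "idt A1 \<one>\<^bsub>P\<^esub>" b x] assms
  by (simp add: braided_simps brd_idt_bd(1))

text \<open>\<open>bd_biact\<close> rewrites \<delta>(x.c) to x.(\<delta> c), which hides the
  boundary from the axiom for {a, \<delta> c}; this instance of the axiom has the rewritten
  shape.\<close>

lemma brd_lact_bd:
  assumes "a \<in> arr A1" "c \<in> arr A2" "x \<in> carrier P"
  shows "brd A a (l1 x (bd (xm A) c)) =
    \<boxminus>\<^bsub>A2\<^esub> l2 (tgt A1 a) (l2 x c) \<boxplus>\<^bsub>A2\<^esub> l2 (src A1 a) (l2 x c) \<star>\<^bsub>xm A\<^esub> r1 a (x \<otimes>\<^bsub>P\<^esub> tgt A2 c)"
  using assms brd_idt_bd(2)[of a "l2 x c"] by (simp add: A2.biact_closed bd_biact)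

text \<open>Expanding {a + (-a), b}, an identity by \<open>brd_idt_left\<close>, shows that {-a, b}
  is a left inverse of {a, b} acted on by the inverse of a.\<beta>b.\<close>

lemma brd_neg_left:
  assumes a: "a \<in> arr A1" and b: "b \<in> arr A1"
  shows "brd A (\<boxminus>\<^bsub>A1\<^esub> a) b = \<boxminus>\<^bsub>A2\<^esub> (brd A a b \<star>\<^bsub>xm A\<^esub> \<boxminus>\<^bsub>A1\<^esub> r1 a (tgt A1 b))"
  using assms brd_rules(4)[of a b "\<boxminus>\<^bsub>A1\<^esub> a"]
  by (intro fib.neg_eqI')
    (simp_all add: braided_simps brd_idt_left brd_rules(1,2) tot_intrans)

section \<open>The groups at the identity object\<close>

abbreviation K where "K \<equiv> star_group A"
abbreviation L where "L \<equiv> loop_group A"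

lemma star_simps:
  "a \<in> carrier K \<longleftrightarrow> a \<in> arr A1 \<and> tgt A1 a = \<one>\<^bsub>P\<^esub>"
  "a \<otimes>\<^bsub>K\<^esub> b = r1 a (src A1 b) \<boxplus>\<^bsub>A1\<^esub> b"
  "\<one>\<^bsub>K\<^esub> = idt A1 \<one>\<^bsub>P\<^esub>"
  by (simp_all add: star_group_def Let_def)

lemma loop_simps:
  "c \<in> carrier L \<longleftrightarrow> c \<in> arr A2 \<and> tgt A2 c = \<one>\<^bsub>P\<^esub>"
  "c \<otimes>\<^bsub>L\<^esub> d = c \<boxplus>\<^bsub>A2\<^esub> d"
  "\<one>\<^bsub>L\<^esub> = idt A2 \<one>\<^bsub>P\<^esub>"
  by (simp_all add: loop_group_def Let_def)

text \<open>The element is the solution of (b.\<alpha>a) + a = \<open>O_e\<close>: translate -a on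
  the right by the inverse of \<alpha>a.\<close>

lemma star_left_inv:
  assumes "a \<in> carrier K"
  shows "\<boxminus>\<^bsub>A1\<^esub> r1 a (inv\<^bsub>P\<^esub> (src A1 a)) \<otimes>\<^bsub>K\<^esub> a = \<one>\<^bsub>K\<^esub>"
    "\<boxminus>\<^bsub>A1\<^esub> r1 a (inv\<^bsub>P\<^esub> (src A1 a)) \<in> carrier K"
  using assms by (simp_all add: star_simps braided_simps)

sublocale K: group K
proof (rule groupI)
  fix a b c
  assume "a \<in> carrier K" "b \<in> carrier K" "c \<in> carrier K"
  then show "a \<otimes>\<^bsub>K\<^esub> b \<otimes>\<^bsub>K\<^esub> c = a \<otimes>\<^bsub>K\<^esub> (b \<otimes>\<^bsub>K\<^esub> c)"
    by (simp add: star_simps braided_simps)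
next
  fix a
  assume "a \<in> carrier K"
  then show "\<exists>b\<in>carrier K. b \<otimes>\<^bsub>K\<^esub> a = \<one>\<^bsub>K\<^esub>"
    using star_left_inv by blast
qed (auto simp: star_simps braided_simps)

sublocale L: group L
proof (rule groupI)
  fix c
  assume "c \<in> carrier L"
  then show "\<exists>d\<in>carrier L. d \<otimes>\<^bsub>L\<^esub> c = \<one>\<^bsub>L\<^esub>"
    by (intro bexI[of _ "\<boxminus>\<^bsub>A2\<^esub> c"]) (simp_all add: loop_simps braided_simps)
qed (auto simp: loop_simps braided_simps)

lemma star_inv: "a \<in> carrier K \<Longrightarrow> inv\<^bsub>K\<^esub> a = \<boxminus>\<^bsub>A1\<^esub> r1 a (inv\<^bsub>P\<^esub> (src A1 a))"
  by (intro K.inv_equality star_left_inv)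

lemma loop_inv: "c \<in> carrier L \<Longrightarrow> inv\<^bsub>L\<^esub> c = \<boxminus>\<^bsub>A2\<^esub> c"
  by (rule L.inv_equality) (simp_all add: loop_simps braided_simps)

section \<open>The Peiffer lifting and its laws\<close>

abbreviation cact where "cact c p \<equiv> r2 (l2 (inv\<^bsub>P\<^esub> p) c) p"
abbreviation aact where "aact a p \<equiv> r1 (l1 (inv\<^bsub>P\<^esub> p) a) p"
abbreviation pl where "pl a b \<equiv> star_act A (brd A (inv\<^bsub>K\<^esub> a) b) a"

text \<open>Right translation by \<alpha>a moves a loop at e to the source of a, and the action of a
  brings it back to e. On boundaries of loops at e the translation is trivial, so the Peiffer rule
  of the groupoid action applies.\<close>

lemma group_crossed_module_star: "group_crossed_module L K (bd (xm A)) (star_act A)"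
  unfolding group_crossed_module_def group_acts_def
  \<comment> \<open>The first pass expands inverses while their arguments are elements of
    \<open>K\<close> and \<open>L\<close>; the second unfolds everything to words in the groupoids.
    The proofs for the lifting follow the same pattern.\<close>
  by (auto simp: L.is_group K.is_group hom_def star_inv loop_inv star_act_def)
   (auto simp: star_simps loop_simps braided_simps)

lemma pl_closed: "\<lbrakk>a \<in> carrier K; b \<in> carrier K\<rbrakk> \<Longrightarrow> pl a b \<in> carrier L"
  by (auto simp: star_inv star_act_def) (auto simp: star_simps loop_simps braided_simps brd_rules)

lemma bd_pl:
  assumes "a \<in> carrier K" "b \<in> carrier K"
  shows "bd (xm A) (pl a b) = inv\<^bsub>K\<^esub> a \<otimes>\<^bsub>K\<^esub> inv\<^bsub>K\<^esub> b \<otimes>\<^bsub>K\<^esub> a \<otimes>\<^bsub>K\<^esub> aact b (src A1 a)"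
  using assms
  by (simp add: star_inv star_act_def) (simp add: star_simps braided_simps brd_rules)

lemma pl_bd:
  assumes "c \<in> carrier L" "a \<in> carrier K"
  shows "pl (bd (xm A) c) a = inv\<^bsub>L\<^esub> c \<otimes>\<^bsub>L\<^esub> star_act A c a"
    "pl a (bd (xm A) c) = inv\<^bsub>L\<^esub> (star_act A c a) \<otimes>\<^bsub>L\<^esub> cact c (src A1 a)"
proof -
  \<comment> \<open>Allows \<open>star_inv\<close> and \<open>loop_inv\<close> to expand the
    inverses of these two elements.\<close>
  have "bd (xm A) c \<in> carrier K" "star_act A c a \<in> carrier L"
    using assms by (auto simp: star_act_def) (auto simp: star_simps loop_simps braided_simps)
  then show "pl (bd (xm A) c) a = inv\<^bsub>L\<^esub> c \<otimes>\<^bsub>L\<^esub> star_act A c a"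
    "pl a (bd (xm A) c) = inv\<^bsub>L\<^esub> (star_act A c a) \<otimes>\<^bsub>L\<^esub> cact c (src A1 a)"
    using assms
    by (simp_all add: star_inv loop_inv star_act_def)
      (simp_all add: star_simps loop_simps braided_simps brd_rules brd_idt_bd brd_lact_bd brd_neg_left)
qed

text \<open>The inverse of a product reverses the factors and the bracket expands its first argument
  in reverse, so the summands appear in the order of the axiom.\<close>

lemma pl_mult_left:
  assumes "a \<in> carrier K" "b \<in> carrier K" "k \<in> carrier K"
  shows "pl (a \<otimes>\<^bsub>K\<^esub> b) k = star_act A (pl a k) b \<otimes>\<^bsub>L\<^esub> pl b (aact k (src A1 a))"
  using assms
  by (simp add: star_inv star_act_def)
    (simp add: star_simps loop_simps braided_simps brd_rules brd_neg_left)

text \<open>Conjugation by p commutes with inversion in \<open>K\<close>, and in the bracket of two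
  conjugates the inner p and its inverse meet and cancel by {a.x, b} = {a, x.b}.\<close>

lemma pl_aact:
  assumes "a \<in> carrier K" "b \<in> carrier K" "p \<in> carrier P"
  shows "cact (pl a b) p = pl (aact a p) (aact b p)"
proof -
  have "aact a p \<in> carrier K" "aact b p \<in> carrier K"
    using assms by (simp_all add: star_simps braided_simps)
  then show ?thesis
    using assms
    by (simp add: star_inv star_act_def)
      (simp add: star_simps loop_simps braided_simps brd_rules brd_neg_left)
qed

text \<open>What expansion of the second argument gives directly. The summand with b comes first and
  is ({inv a, b}!k)!a, that is, \<open>pl a b\<close> acted on by the conjugate of k by a.\<close>

lemma pl_mult_right_conj:
  assumes "a \<in> carrier K" "b \<in> carrier K" "k \<in> carrier K"
  shows "pl a (b \<otimes>\<^bsub>K\<^esub> k) = star_act A (pl a b) (inv\<^bsub>K\<^esub> a \<otimes>\<^bsub>K\<^esub> k \<otimes>\<^bsub>K\<^esub> a) \<otimes>\<^bsub>L\<^esub> pl a k"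
  using assms
  by (simp add: star_inv star_act_def)
    (simp add: star_simps loop_simps braided_simps brd_rules brd_neg_left)

text \<open>The two summands of the expansion of \<open>{inv a, b k}!a\<close> are swapped by conjugating with
  \<open>pl a k\<close>, that is, by letting \<open>\<delta> (pl a k)\<close> act.\<close>

lemma pl_mult_right:
  assumes a: "a \<in> carrier K" and b: "b \<in> carrier K" and k: "k \<in> carrier K"
  shows "pl a (b \<otimes>\<^bsub>K\<^esub> k) = pl a k \<otimes>\<^bsub>L\<^esub> star_act A (pl a b) (aact k (src A1 a))"
proof -
  let ?k = "aact k (src A1 a)" and ?c = "inv\<^bsub>K\<^esub> a \<otimes>\<^bsub>K\<^esub> k \<otimes>\<^bsub>K\<^esub> a"
  have cm: "group_acts K L (star_act A)"
    "\<forall>n\<in>carrier L. \<forall>n'\<in>carrier L.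
       star_act A n (bd (xm A) n') = inv\<^bsub>L\<^esub> n' \<otimes>\<^bsub>L\<^esub> n \<otimes>\<^bsub>L\<^esub> n'"
    "bd (xm A) \<in> hom L K"
    using group_crossed_module_star unfolding group_crossed_module_def by blast+
  have kc: "?k \<in> carrier K" "?c \<in> carrier K"
    using a k by (simp add: star_simps braided_simps, simp)
  have pk: "pl a k \<in> carrier L" "pl a b \<in> carrier L" "bd (xm A) (pl a k) \<in> carrier K"
    using a b k pl_closed cm(3) by (auto simp: hom_def)
  \<comment> \<open>By \<open>bd_pl\<close> the boundary is inv a inv k a \<open>?k\<close>, and its
    first three factors are the inverse of \<open>?c\<close>.\<close>
  have "?c \<otimes>\<^bsub>K\<^esub> bd (xm A) (pl a k) = ?k"
    using a k kc(1) bd_pl[OF a k] by (simp add: K.group_word_simps)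
  then have "star_act A (pl a b) ?k = star_act A (star_act A (pl a b) ?c) (bd (xm A) (pl a k))"
    using cm(1) kc pk unfolding group_acts_def by metis
  also have "\<dots> = inv\<^bsub>L\<^esub> (pl a k) \<otimes>\<^bsub>L\<^esub> star_act A (pl a b) ?c \<otimes>\<^bsub>L\<^esub> pl a k"
    using cm(1,2) kc pk unfolding group_acts_def by blast
  finally show ?thesis
    using cm(1) kc pk pl_mult_right_conj[OF a b k] 
    by (simp add: group_acts_def L.group_word_simps)
qed

lemma group_acts_conj: "group_acts P L cact" "group_acts P K aact"
  by (auto simp: group_acts_def) (auto simp: star_simps loop_simps braided_simps)

lemma hom_bd_src: "bd (xm A) \<in> hom L K" "src A1 \<in> hom K P"
  by (auto simp: hom_def) (auto simp: star_simps loop_simps braided_simps)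

theorem two_crossed_module_assoc: "two_crossed_module (assoc_xmod2 A)"
proof -
  have 1: "cact (star_act A c a) p = star_act A (cact c p) (aact a p)"
    if "c \<in> carrier L" "a \<in> carrier K" "p \<in> carrier P" for c a p
    using that by (simp add: star_act_def) (simp add: star_simps loop_simps braided_simps)
  have 2: "src A1 (bd (xm A) c) = \<one>\<^bsub>P\<^esub>" 
    "p \<in> carrier P \<Longrightarrow> bd (xm A) (cact c p) = aact (bd (xm A) c) p"
    if "c \<in> carrier L" for c p
    using that by (simp_all add: star_simps loop_simps braided_simps)
  have 3: "src A1 (aact a p) = inv\<^bsub>P\<^esub> p \<otimes>\<^bsub>P\<^esub> src A1 a \<otimes>\<^bsub>P\<^esub> p"
    if "a \<in> carrier K" "p \<in> carrier P" for a p
    using that by (simp_all add: star_simps loop_simps braided_simps)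
  show ?thesis
    unfolding two_crossed_module_def assoc_xmod2_def Let_def xmod2.simps
    by (intro conjI ballI)
      (assumption | rule L.is_group K.is_group P.is_group group_crossed_module_star pl_closed bd_pl
        pl_bd pl_mult_left pl_mult_right pl_aact group_acts_conj hom_bd_src 1 2 3)+
qed

end

section \<open>Free derivations and transport of structure\<close>

text \<open>An injective multiplicative map reflects the group laws, and surjectivity supplies
  inverses. The group laws of \<open>FDer_units X\<close> and \<open>M2 X\<close> are thus obtained
  from those of \<open>K\<close> and \<open>L\<close>.\<close>

lemma group_pullback:
  assumes "\<phi> \<in> iso H H'" "group H'" "\<one>\<^bsub>H\<^esub> \<in> carrier H" "\<phi> \<one>\<^bsub>H\<^esub> = \<one>\<^bsub>H'\<^esub>"
    and closed: "\<And>x y. \<lbrakk>x \<in> carrier H; y \<in> carrier H\<rbrakk> \<Longrightarrow> x \<otimes>\<^bsub>H\<^esub> y \<in> carrier H"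
  shows "group H"
proof -
  interpret H': group H' by fact
  have hom: "\<phi> (x \<otimes>\<^bsub>H\<^esub> y) = \<phi> x \<otimes>\<^bsub>H'\<^esub> \<phi> y" "\<phi> x \<in> carrier H'"
    if "x \<in> carrier H" "y \<in> carrier H" for x y
    using assms(1) that by (auto simp: iso_def hom_def)
  have inj: "inj_on \<phi> (carrier H)" and surj: "\<phi> ` carrier H = carrier H'"
    using assms(1) by (auto simp: iso_def bij_betw_def)
  show ?thesis
  proof (rule groupI)
    fix x assume x: "x \<in> carrier H"
    then have "inv\<^bsub>H'\<^esub> \<phi> x \<in> carrier H'" using hom by blast
    then obtain y where y: "y \<in> carrier H" "\<phi> y = inv\<^bsub>H'\<^esub> \<phi> x" using surj by (metis imageE)
    then have "\<phi> (y \<otimes>\<^bsub>H\<^esub> x) = \<phi> \<one>\<^bsub>H\<^esub>" using x hom assms(4) by simp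
    then show "\<exists>y\<in>carrier H. y \<otimes>\<^bsub>H\<^esub> x = \<one>\<^bsub>H\<^esub>"
      using inj_onD[OF inj] x y(1) closed assms(3) by blast
  qed (use assms closed hom in \<open>auto intro!: inj_onD[OF inj] simp: H'.m_assoc\<close>)
qed

text \<open>Apart from closure and the group laws, every axiom is an equation, which can be compared
  after applying one of the three injective maps; there it is the same axiom of
  \<open>T'\<close>.\<close>

lemma two_crossed_module_pullback:
  assumes iso: "xmod2_iso T T' \<phi>\<^sub>L \<phi>\<^sub>M \<phi>\<^sub>P" and T': "two_crossed_module T'"
    and grp: "group (gL T)" "group (gM T)" "group (gP T)"
    and cl: "\<And>l. l \<in> carrier (gL T) \<Longrightarrow> dL T l \<in> carrier (gM T)"
      "\<And>m. m \<in> carrier (gM T) \<Longrightarrow> dM T m \<in> carrier (gP T)"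
      "\<And>l p. \<lbrakk>l \<in> carrier (gL T); p \<in> carrier (gP T)\<rbrakk> \<Longrightarrow> actLP T l p \<in> carrier (gL T)"
      "\<And>m p. \<lbrakk>m \<in> carrier (gM T); p \<in> carrier (gP T)\<rbrakk> \<Longrightarrow> actMP T m p \<in> carrier (gM T)"
      "\<And>l m. \<lbrakk>l \<in> carrier (gL T); m \<in> carrier (gM T)\<rbrakk> \<Longrightarrow> actLM T l m \<in> carrier (gL T)"
      "\<And>m n. \<lbrakk>m \<in> carrier (gM T); n \<in> carrier (gM T)\<rbrakk> \<Longrightarrow> plift T m n \<in> carrier (gL T)"
  shows "two_crossed_module T"
proof -
  interpret L: group "gL T" by fact
  interpret M: group "gM T" by fact
  interpret P: group "gP T" by fact
  have grp': "group (gL T')" "group (gM T')" "group (gP T')"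
    using T' by (simp_all add: two_crossed_module_def Let_def)
  have hL: "group_hom (gL T) (gL T') \<phi>\<^sub>L" and hM: "group_hom (gM T) (gM T') \<phi>\<^sub>M"
    and hP: "group_hom (gP T) (gP T') \<phi>\<^sub>P"
    using iso grp grp' by (auto simp: group_hom_def group_hom_axioms_def xmod2_iso_def iso_def)
  interpret hL: group_hom "gL T" "gL T'" \<phi>\<^sub>L by fact
  interpret hM: group_hom "gM T" "gM T'" \<phi>\<^sub>M by fact
  interpret hP: group_hom "gP T" "gP T'" \<phi>\<^sub>P by fact
  have inj: "inj_on \<phi>\<^sub>L (carrier (gL T))" "inj_on \<phi>\<^sub>M (carrier (gM T))" "inj_on \<phi>\<^sub>P (carrier (gP T))"
    using iso by (auto simp: xmod2_iso_def iso_def bij_betw_def)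
  note eqI = inj[THEN inj_onD]
  have tr: "\<And>l. l \<in> carrier (gL T) \<Longrightarrow> \<phi>\<^sub>M (dL T l) = dL T' (\<phi>\<^sub>L l)"
    "\<And>m. m \<in> carrier (gM T) \<Longrightarrow> \<phi>\<^sub>P (dM T m) = dM T' (\<phi>\<^sub>M m)"
    "\<And>l p. \<lbrakk>l \<in> carrier (gL T); p \<in> carrier (gP T)\<rbrakk> \<Longrightarrow> \<phi>\<^sub>L (actLP T l p) = actLP T' (\<phi>\<^sub>L l) (\<phi>\<^sub>P p)"
    "\<And>m p. \<lbrakk>m \<in> carrier (gM T); p \<in> carrier (gP T)\<rbrakk> \<Longrightarrow> \<phi>\<^sub>M (actMP T m p) = actMP T' (\<phi>\<^sub>M m) (\<phi>\<^sub>P p)"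
    "\<And>l m. \<lbrakk>l \<in> carrier (gL T); m \<in> carrier (gM T)\<rbrakk> \<Longrightarrow> \<phi>\<^sub>L (actLM T l m) = actLM T' (\<phi>\<^sub>L l) (\<phi>\<^sub>M m)"
    "\<And>m n. \<lbrakk>m \<in> carrier (gM T); n \<in> carrier (gM T)\<rbrakk> \<Longrightarrow> \<phi>\<^sub>L (plift T m n) = plift T' (\<phi>\<^sub>M m) (\<phi>\<^sub>M n)"
    using iso by (simp_all add: xmod2_iso_def)
  note T'_rules = T'[unfolded two_crossed_module_def group_crossed_module_def group_acts_def Let_def]
  have "dL T' \<in> hom (gL T') (gM T')" "dM T' \<in> hom (gM T') (gP T')"
    using T'_rules by simp_all
  note hom = this[THEN hom_mult]
  show ?thesis
    unfolding two_crossed_module_def group_crossed_module_def group_acts_def Let_def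
    by (intro conjI ballI homI grp cl; (assumption | rule cl)?; (rule eqI)?)
      (simp_all add: cl tr T'_rules hom)
qed

section \<open>Free derivations as elements of K\<close>

context crossed_module
begin

interpretation B: braided "AUT X"
  by unfold_locales (rule braided_AUT)

lemma star_AUT:
  "s \<in> carrier (star_group (AUT X)) \<longleftrightarrow>
     homotopy X s \<and> hbase s = \<one>\<^bsub>End_monoid X\<^esub> \<and> hsource X s \<in> carrier (Aut X)"
  "s \<otimes>\<^bsub>star_group (AUT X)\<^esub> t = ract1 (AUT X) s (hsource X t) \<boxplus>\<^bsub>AUT_1 X\<^esub> t"
  "\<one>\<^bsub>star_group (AUT X)\<^esub> = idt (AUT_1 X) \<one>\<^bsub>End_monoid X\<^esub>"
  by (auto simp: star_group_def Let_def AUT_simps)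

lemma fder_htpy_simps:
  "h0 (fder_htpy X s) = fst s" "h1 (fder_htpy X s) = snd s"
  "hbase (fder_htpy X s) = \<one>\<^bsub>End_monoid X\<^esub>"
  "hsource X (fder_htpy X s) = Delta X s"
  by (simp_all add: fder_htpy_def Delta_def)

lemma fder_htpy_inj: "fder_htpy X s = fder_htpy X t \<longleftrightarrow> s = t"
  by (auto simp: fder_htpy_def prod_eq_iff)

lemma fder_htpy_surj: "hbase s = \<one>\<^bsub>End_monoid X\<^esub> \<Longrightarrow> fder_htpy X (h0 s, h1 s) = s"
  by (simp add: fder_htpy_def)

lemma FDer_simps:
  "s \<in> carrier (FDer X) \<longleftrightarrow> homotopy X (fder_htpy X s)"
  "fder_htpy X \<one>\<^bsub>FDer X\<^esub> = idt (AUT_1 X) \<one>\<^bsub>End_monoid X\<^esub>"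
proof -
  show "s \<in> carrier (FDer X) \<longleftrightarrow> homotopy X (fder_htpy X s)"
    by (simp add: FDer_def Let_def)
  show "fder_htpy X \<one>\<^bsub>FDer X\<^esub> = idt (AUT_1 X) \<one>\<^bsub>End_monoid X\<^esub>"
    by (auto simp: FDer_def AUT_1_def Let_def fder_htpy_def End_monoid_def fun_eq_iff restrict_def
      base.tgt_closed simp flip: G_def C_def)
qed

text \<open>This is the product of \<open>star_group (AUT X)\<close>, extended to free derivations
  whose source need not be an automorphism. Since a sum has the source of its first summand, here
  \<Delta>(s) \<Delta>(t), the map \<Delta> is multiplicative.\<close>

lemma fder_htpy_mult:
  assumes "s \<in> carrier (FDer X)" "t \<in> carrier (FDer X)"
  shows "fder_htpy X (s \<otimes>\<^bsub>FDer X\<^esub> t) = ract1 (AUT X) (fder_htpy X s) (Delta X t) \<boxplus>\<^bsub>AUT_1 X\<^esub> fder_htpy X t"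
    "s \<otimes>\<^bsub>FDer X\<^esub> t \<in> carrier (FDer X)"
    "Delta X (s \<otimes>\<^bsub>FDer X\<^esub> t) = Delta X s \<otimes>\<^bsub>End_monoid X\<^esub> Delta X t"
proof -
  obtain s0 s1 t0 t1 where st: "s = (s0, s1)" "t = (t0, t1)" by (cases s; cases t)
  show 1: "fder_htpy X (s \<otimes>\<^bsub>FDer X\<^esub> t) =
      ract1 (AUT X) (fder_htpy X s) (Delta X t) \<boxplus>\<^bsub>AUT_1 X\<^esub> fder_htpy X t"
    by (auto simp: st FDer_def Let_def fder_htpy_def AUT_1_def AUT_def compose_def restrict_def
      fun_eq_iff)
  have D: "Delta X t \<in> xend X"
    using assms hsource_xend by (simp add: Delta_def FDer_simps)
  have h: "homotopy X (ract1 (AUT X) (fder_htpy X s) (Delta X t))"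
    "hbase (ract1 (AUT X) (fder_htpy X s) (Delta X t)) = hsource X (fder_htpy X t)"
    using assms D by (simp_all add: FDer_simps homotopy_ract1 lract1_simps fder_htpy_simps End_simps)
  then show "s \<otimes>\<^bsub>FDer X\<^esub> t \<in> carrier (FDer X)"
    using assms 1 by (simp add: FDer_simps homotopy_AUT_1_add)
  show "Delta X (s \<otimes>\<^bsub>FDer X\<^esub> t) = Delta X s \<otimes>\<^bsub>End_monoid X\<^esub> Delta X t"
    using assms D h unfolding Delta_def[of X "s \<otimes>\<^bsub>FDer X\<^esub> t"] 1
    by (simp add: FDer_simps hsource_AUT_1_add hsource_ract1 fder_htpy_simps)
qed

lemma FDer_one:
  "\<one>\<^bsub>FDer X\<^esub> \<in> carrier (FDer X)" "Delta X \<one>\<^bsub>FDer X\<^esub> = \<one>\<^bsub>End_monoid X\<^esub>"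
  by (simp_all add: FDer_simps Delta_def homotopy_AUT_1_idt hsource_AUT_1_idt End_one_closed)

lemma FDer_units_simps:
  "mult (FDer_units X) = mult (FDer X)" "\<one>\<^bsub>FDer_units X\<^esub> = \<one>\<^bsub>FDer X\<^esub>"
  by (simp_all add: FDer_units_def units_of_def)

text \<open>Inverse free derivations have inverse sources because \<Delta> respects products and
  units. Conversely, if \<Delta>(s) is an automorphism then s lies in the group K, and its inverse
  there has base I and so is a free derivation.\<close>

lemma FDer_units_iff:
  "s \<in> carrier (FDer_units X) \<longleftrightarrow> s \<in> carrier (FDer X) \<and> Delta X s \<in> carrier (Aut X)"
proof
  assume "s \<in> carrier (FDer_units X)"
  then obtain t where t: "s \<in> carrier (FDer X)" "t \<in> carrier (FDer X)"
    "t \<otimes>\<^bsub>FDer X\<^esub> s = \<one>\<^bsub>FDer X\<^esub>" "s \<otimes>\<^bsub>FDer X\<^esub> t = \<one>\<^bsub>FDer X\<^esub>"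
    by (auto simp: FDer_units_def units_of_def Units_def)
  then have "Delta X t \<otimes>\<^bsub>End_monoid X\<^esub> Delta X s = \<one>\<^bsub>End_monoid X\<^esub>"
    "Delta X s \<otimes>\<^bsub>End_monoid X\<^esub> Delta X t = \<one>\<^bsub>End_monoid X\<^esub>"
    by (simp_all flip: fder_htpy_mult(3) add: FDer_one)
  moreover have "Delta X s \<in> xend X" "Delta X t \<in> xend X"
    using t hsource_xend by (simp_all add: Delta_def FDer_simps)
  ultimately show "s \<in> carrier (FDer X) \<and> Delta X s \<in> carrier (Aut X)"
    using t unfolding Aut_def units_of_carrier Units_def End_simps by blast
next
  assume s: "s \<in> carrier (FDer X) \<and> Delta X s \<in> carrier (Aut X)"
  let ?K = "star_group (AUT X)"
  have sK: "fder_htpy X s \<in> carrier ?K"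
    using s by (simp add: star_AUT fder_htpy_simps FDer_simps)
  define t where "t = inv\<^bsub>?K\<^esub> fder_htpy X s"
  have t: "t \<in> carrier ?K" "t \<otimes>\<^bsub>?K\<^esub> fder_htpy X s = \<one>\<^bsub>?K\<^esub>" "fder_htpy X s \<otimes>\<^bsub>?K\<^esub> t = \<one>\<^bsub>?K\<^esub>"
    using sK by (simp_all add: t_def)
  define t' where "t' = (h0 t, h1 t)"
  have tt': "t = fder_htpy X t'"
    using t(1) by (simp add: t'_def fder_htpy_surj star_AUT)
  have "t' \<in> carrier (FDer X)"
    using t(1) by (simp add: tt' star_AUT FDer_simps)
  moreover from this have "fder_htpy X (t' \<otimes>\<^bsub>FDer X\<^esub> s) = fder_htpy X \<one>\<^bsub>FDer X\<^esub>"
    "fder_htpy X (s \<otimes>\<^bsub>FDer X\<^esub> t') = fder_htpy X \<one>\<^bsub>FDer X\<^esub>"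
    using s t(2,3) unfolding tt' star_AUT(2,3)
    by (simp_all add: fder_htpy_mult(1) FDer_simps(2) fder_htpy_simps(4))
  ultimately show "s \<in> carrier (FDer_units X)"
    using s unfolding FDer_units_def units_of_carrier Units_def fder_htpy_inj by blast
qed

lemma fder_htpy_star:
  "fder_htpy X s \<in> carrier (star_group (AUT X)) \<longleftrightarrow> s \<in> carrier (FDer_units X)"
  by (simp add: FDer_units_iff star_AUT fder_htpy_simps FDer_simps)

lemma fder_htpy_iso: "fder_htpy X \<in> iso (FDer_units X) (star_group (AUT X))"
proof (rule isoI)
  show "fder_htpy X \<in> hom (FDer_units X) (star_group (AUT X))"
    by (auto simp: hom_def fder_htpy_star)
      (simp add: FDer_units_iff FDer_units_simps fder_htpy_mult star_AUT fder_htpy_simps)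
  show "bij_betw (fder_htpy X) (carrier (FDer_units X)) (carrier (star_group (AUT X)))"
  proof (rule bij_betw_imageI)
    show "inj_on (fder_htpy X) (carrier (FDer_units X))"
      by (simp add: inj_on_def fder_htpy_inj)
    show "fder_htpy X ` carrier (FDer_units X) = carrier (star_group (AUT X))"
    proof (intro equalityI subsetI)
      fix s assume s: "s \<in> carrier (star_group (AUT X))"
      then have eq: "fder_htpy X (h0 s, h1 s) = s" by (simp add: fder_htpy_surj star_AUT)
      then have "(h0 s, h1 s) \<in> carrier (FDer_units X)" using s fder_htpy_star[of "(h0 s, h1 s)"] by simp
      then show "s \<in> fder_htpy X ` carrier (FDer_units X)" using eq by (metis image_eqI)
    qed (auto simp: fder_htpy_star)
  qed
qed

lemma group_FDer_units: "group (FDer_units X)"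
proof (rule group_pullback[OF fder_htpy_iso B.K.is_group])
  show "\<one>\<^bsub>FDer_units X\<^esub> \<in> carrier (FDer_units X)"
    by (simp add: FDer_units_iff FDer_units_simps FDer_one Aut_closed)
  show "fder_htpy X \<one>\<^bsub>FDer_units X\<^esub> = \<one>\<^bsub>star_group (AUT X)\<^esub>"
    by (simp add: FDer_units_simps FDer_simps star_AUT)
  fix s t assume "s \<in> carrier (FDer_units X)" "t \<in> carrier (FDer_units X)"
  then show "s \<otimes>\<^bsub>FDer_units X\<^esub> t \<in> carrier (FDer_units X)"
    by (simp add: FDer_units_iff FDer_units_simps fder_htpy_mult Aut_closed)
qed

section \<open>Sections, maps and actions of the sequence\<close>

lemma loop_AUT:
  "(s, f) \<in> carrier (loop_group (AUT X)) \<longleftrightarrow> f = \<one>\<^bsub>End_monoid X\<^esub> \<and> s \<in> carrier (M2 X)"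
  by (auto simp: loop_group_def M2_def Let_def AUT_simps PiE_def simp flip: G_def C_def)

lemma M2_iso: "(\<lambda>s. (s, \<one>\<^bsub>End_monoid X\<^esub>)) \<in> iso (M2 X) (loop_group (AUT X))"
proof (rule isoI)
  show "(\<lambda>s. (s, \<one>\<^bsub>End_monoid X\<^esub>)) \<in> hom (M2 X) (loop_group (AUT X))"
    by (auto simp: hom_def loop_AUT)
      (simp add: loop_group_def M2_def Let_def AUT_simps flip: G_def C_def)
  show "bij_betw (\<lambda>s. (s, \<one>\<^bsub>End_monoid X\<^esub>)) (carrier (M2 X)) (carrier (loop_group (AUT X)))"
    by (auto simp: bij_betw_def inj_on_def loop_AUT)
qed

lemma group_M2: "group (M2 X)"
  by (rule group_pullback[OF M2_iso B.L.is_group])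
    (auto simp: M2_def loop_group_def Let_def AUT_simps xmod_simps PiE_def Pi_iff
      intro!: extensionalityI[of _ "obj G"] simp flip: G_def C_def)

text \<open>At f = I the twist by \<open>m1 f\<close> in \<open>\<delta>(s_2, f)\<close> is trivial,
  which leaves the formula for \<zeta>.\<close>

lemma zeta_fder_htpy: "fder_htpy X (zeta X s) = bd (AUT_xmod X) (s, \<one>\<^bsub>End_monoid X\<^esub>)"
  by (auto simp: fder_htpy_def zeta_def AUT_xmod_def Let_def End_monoid_def fun_eq_iff)

text \<open>Ensures that conjugating a free derivation or a section keeps it over I.\<close>

lemma Aut_inv_conj:
  assumes "f \<in> carrier (Aut X)"
  shows "inv\<^bsub>Aut X\<^esub> f \<otimes>\<^bsub>End_monoid X\<^esub> \<one>\<^bsub>End_monoid X\<^esub> \<otimes>\<^bsub>End_monoid X\<^esub> f = \<one>\<^bsub>End_monoid X\<^esub>"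
  using assms Aut.l_inv[OF assms] Aut.r_one[of "inv\<^bsub>Aut X\<^esub> f"] by (simp add: Aut_simps)

lemma fder_htpy_Aut_on_FDer:
  assumes "f \<in> carrier (Aut X)"
  shows "fder_htpy X (Aut_on_FDer X s f) =
    ract1 (AUT X) (lact1 (AUT X) (inv\<^bsub>Aut X\<^esub> f) (fder_htpy X s)) f"
proof (rule htpy.equality)
  show "h0 (fder_htpy X (Aut_on_FDer X s f)) =
      h0 (ract1 (AUT X) (lact1 (AUT X) (inv\<^bsub>Aut X\<^esub> f) (fder_htpy X s)) f)"
    by (rule extensionalityI[of _ "obj G"])
      (use assms in \<open>auto simp: Aut_xend fder_htpy_simps Aut_on_FDer_def Let_def lract1_simps xend_rules
        simp flip: G_def C_def\<close>)
  show "h1 (fder_htpy X (Aut_on_FDer X s f)) =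
      h1 (ract1 (AUT X) (lact1 (AUT X) (inv\<^bsub>Aut X\<^esub> f) (fder_htpy X s)) f)"
    by (rule extensionalityI[of _ "arr G"])
      (use assms in \<open>auto simp: Aut_xend fder_htpy_simps Aut_on_FDer_def Let_def lract1_simps xend_rules
        simp flip: G_def C_def\<close>)
qed (use assms in \<open>simp_all add: fder_htpy_simps lract1_simps Aut_inv_conj\<close>)

lemma Aut_on_M2_pair:
  assumes "f \<in> carrier (Aut X)"
  shows "(Aut_on_M2 X s f, \<one>\<^bsub>End_monoid X\<^esub>) =
    ract2 (AUT X) (lact2 (AUT X) (inv\<^bsub>Aut X\<^esub> f) (s, \<one>\<^bsub>End_monoid X\<^esub>)) f"
  using assms
  by (auto simp: Aut_xend lract2_simps Aut_on_M2_def Aut_inv_conj xend_rules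
    intro!: extensionalityI[of _ "obj G"] simp flip: G_def C_def)

text \<open>\<open>star_act\<close> first translates s by the source \<Delta>(t), whose object map
  sends x to \<open>\<alpha> t_0(x)\<close>, and then acts by \<open>t_0(x)\<close>.\<close>

lemma FDer_on_M2_pair:
  assumes "t \<in> carrier (FDer_units X)"
  shows "(FDer_on_M2 X s t, \<one>\<^bsub>End_monoid X\<^esub>) =
    star_act (AUT X) (s, \<one>\<^bsub>End_monoid X\<^esub>) (fder_htpy X t)"
proof -
  have "homotopy X (fder_htpy X t)" using assms by (simp add: FDer_units_iff FDer_simps)
  from homotopyD(4)[OF this] show ?thesis
    by (auto simp: star_act_def AUT_simps FDer_on_M2_def fder_htpy_simps(1-3) hsource_simps
      intro!: extensionalityI[of _ "obj G"] simp flip: G_def C_def)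
qed

text \<open>The Peiffer lifting carried back from K. Taking \<open>fst\<close> drops only the
  automorphism, which is I because the values lie in the loop group.\<close>

abbreviation der_plift where
  "der_plift s t \<equiv> fst (plift (assoc_xmod2 (AUT X)) (fder_htpy X s) (fder_htpy X t))"

lemma plift_assoc_closed:
  assumes "s \<in> carrier (FDer_units X)" "t \<in> carrier (FDer_units X)"
  shows "plift (assoc_xmod2 (AUT X)) (fder_htpy X s) (fder_htpy X t) \<in> carrier (loop_group (AUT X))"
  using assms B.pl_closed by (simp add: assoc_xmod2_def Let_def fder_htpy_star)

lemma der_sequence_iso:
  "xmod2_iso (der_sequence X der_plift) (assoc_xmod2 (AUT X))
     (\<lambda>s. (s, \<one>\<^bsub>End_monoid X\<^esub>)) (fder_htpy X) (\<lambda>f. f)"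
proof -
  have "(der_plift s t, \<one>\<^bsub>End_monoid X\<^esub>) = plift (assoc_xmod2 (AUT X)) (fder_htpy X s) (fder_htpy X t)"
    if "s \<in> carrier (FDer_units X)" "t \<in> carrier (FDer_units X)" for s t
    using plift_assoc_closed[OF that]
    by (cases "plift (assoc_xmod2 (AUT X)) (fder_htpy X s) (fder_htpy X t)") (simp add: loop_AUT)
  moreover have "(\<lambda>f. f) \<in> iso (Aut X) (Aut X)"
    by (rule iso_set_refl)
  ultimately show ?thesis
    unfolding xmod2_iso_def der_sequence_def xmod2.simps
    by (simp add: assoc_xmod2_def Let_def M2_iso fder_htpy_iso AUT_sel AUT_1_simps(3) AUT_xmod_simps(1)
      zeta_fder_htpy fder_htpy_simps fder_htpy_Aut_on_FDer Aut_on_M2_pair FDer_on_M2_pair)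
qed

text \<open>The axioms are pulled back along \<open>der_sequence_iso\<close>; what remains are the
  group laws and closure, and closure of the actions and of \<zeta> is inherited from the associated
  2-crossed module.\<close>

lemma two_crossed_module_der: "two_crossed_module (der_sequence X der_plift)"
proof (rule two_crossed_module_pullback[OF der_sequence_iso B.two_crossed_module_assoc])
  let ?I = "\<one>\<^bsub>End_monoid X\<^esub>"
  have "group_acts (star_group (AUT X)) (loop_group (AUT X)) (star_act (AUT X))"
    using B.group_crossed_module_star by (simp add: group_crossed_module_def)
  note T = this B.hom_bd_src(1) B.group_acts_conj[unfolded AUT_sel]
  have sel: "gL (assoc_xmod2 (AUT X)) = loop_group (AUT X)" 
    "gM (assoc_xmod2 (AUT X)) = star_group (AUT X)" "gP (assoc_xmod2 (AUT X)) = Aut X"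
    "dL (assoc_xmod2 (AUT X)) = bd (AUT_xmod X)"
    "actLM (assoc_xmod2 (AUT X)) = star_act (AUT X)"
    "actLP (assoc_xmod2 (AUT X)) = (\<lambda>c p. ract2 (AUT X) (lact2 (AUT X) (inv\<^bsub>Aut X\<^esub> p) c) p)"
    "actMP (assoc_xmod2 (AUT X)) = (\<lambda>a p. ract1 (AUT X) (lact1 (AUT X) (inv\<^bsub>Aut X\<^esub> p) a) p)"
    by (simp_all add: assoc_xmod2_def Let_def AUT_sel)
  show "group (gL (der_sequence X der_plift))" "group (gM (der_sequence X der_plift))"
    "group (gP (der_sequence X der_plift))"
    by (simp_all add: der_sequence_def group_M2 group_FDer_units)
  \<comment> \<open>The carriers are preimages of those of the associated 2-crossed module, so
    membership can be tested there.\<close>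
  have L: "s \<in> carrier (M2 X) \<longleftrightarrow> (s, ?I) \<in> carrier (gL (assoc_xmod2 (AUT X)))" for s
    by (simp add: loop_AUT sel)
  have M: "s \<in> carrier (FDer_units X) \<longleftrightarrow> fder_htpy X s \<in> carrier (gM (assoc_xmod2 (AUT X)))" for s
    by (simp add: fder_htpy_star sel)
  show "dL (der_sequence X der_plift) l \<in> carrier (gM (der_sequence X der_plift))"
    if "l \<in> carrier (gL (der_sequence X der_plift))" for l
    using that T(2) by (simp add: der_sequence_def L M zeta_fder_htpy hom_def Pi_iff sel AUT_sel)
  show "dM (der_sequence X der_plift) m \<in> carrier (gP (der_sequence X der_plift))"
    if "m \<in> carrier (gM (der_sequence X der_plift))" for m
    using that by (simp add: der_sequence_def FDer_units_iff)
  show "actLP (der_sequence X der_plift) l p \<in> carrier (gL (der_sequence X der_plift))"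
    if "l \<in> carrier (gL (der_sequence X der_plift))" "p \<in> carrier (gP (der_sequence X der_plift))" for l p
    using that T(3) by (simp add: group_acts_def der_sequence_def L Aut_on_M2_pair sel)
  show "actMP (der_sequence X der_plift) m p \<in> carrier (gM (der_sequence X der_plift))"
    if "m \<in> carrier (gM (der_sequence X der_plift))" "p \<in> carrier (gP (der_sequence X der_plift))" for m p
    using that T(4) by (simp add: group_acts_def der_sequence_def M fder_htpy_Aut_on_FDer sel)
  show "actLM (der_sequence X der_plift) l m \<in> carrier (gL (der_sequence X der_plift))"
    if "l \<in> carrier (gL (der_sequence X der_plift))" "m \<in> carrier (gM (der_sequence X der_plift))" for l m
    using that T(1) by (simp add: group_acts_def der_sequence_def L FDer_on_M2_pair) (simp add: M sel)
  show "plift (der_sequence X der_plift) m n \<in> carrier (gL (der_sequence X der_plift))"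
    if "m \<in> carrier (gM (der_sequence X der_plift))" "n \<in> carrier (gM (der_sequence X der_plift))" for m n
    using that plift_assoc_closed[of m n]
    by (cases "plift (assoc_xmod2 (AUT X)) (fder_htpy X m) (fder_htpy X n)")
      (simp add: der_sequence_def loop_AUT)
qed

end

theorem theorem4p3:
  fixes C :: "('x, 'g, 'c) xmod"
  assumes "crossed_module C"
  shows "braided_regular (AUT C) \<and>
    two_crossed_module (assoc_xmod2 (AUT C)) \<and>
    (\<exists>pl. two_crossed_module (der_sequence C pl) \<and>
      xmod2_iso (der_sequence C pl) (assoc_xmod2 (AUT C))
        (\<lambda>s2. (s2, \<one>\<^bsub>Aut C\<^esub>))
        (\<lambda>(s0, s1). \<lparr>h0 = s0, h1 = s1, hbase = \<one>\<^bsub>Aut C\<^esub>\<rparr>)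
        (\<lambda>f. f))"
proof -
  interpret crossed_module C "base C" "fib C" by fact simp_all
  interpret B: braided "AUT C"
    by unfold_locales (rule braided_AUT)
  have "fder_htpy C = (\<lambda>(s0, s1). \<lparr>h0 = s0, h1 = s1, hbase = \<one>\<^bsub>Aut C\<^esub>\<rparr>)"
    by (auto simp: fder_htpy_def fun_eq_iff Aut_simps)
  then show ?thesis
    using braided_AUT B.two_crossed_module_assoc two_crossed_module_der der_sequence_iso
    by (auto simp: Aut_simps)
qed

end
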